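(* Let $X$ be $2^\omega$ or $\mathbb{R}$, let $\mathcal{M}$ be the $\sigma$-ideal of meager subsets of $X$ and $\mathcal{N}$ the $\sigma$-ideal of null subsets of $X$. Then there is a $\Sigma^0_3$ set $U\subseteq\omega^\omega\times(X\times X)$ that is universal for $\mathcal{M}\otimes\mathcal{N}$, and there is a $\Sigma^0_3$ set $V\subseteq\omega^\omega\times(X\times X)$ that is universal for $\mathcal{N}\otimes\mathcal{M}$.
   Context: Null sets are taken with respect to the Haar measure (product of uniform measures on $\{0,1\}$) if $X=2^\omega$, and Lebesgue measure if $X=\mathbb{R}$. For a set $B\subseteq X\times Y$ and $x\in X$, $B_x=\{y\in Y:(x,y)\in B\}$. For $\sigma$-ideals $\mathcal{I}$ and $\mathcal{J}$ of subsets of Polish spaces $X$ and $Y$ respectively, the Fubini product $\mathcal{I}\otimes\mathcal{J}$ is the family of those $A\subseteq X\times Y$ for which there is a Borel set $B\subseteq X\times Y$ with $A\subseteq B$ and $\{x\in X:B_x\notin\mathcal{J}\}\in\mathcal{I}$. A base of an ideal $\mathcal{I}$ of subsets of a space $Z$ is a family $\mathcal{F}\subseteq\mathcal{I}$ such that for each $A\in\mathcal{I}$ there is $A'\in\mathcal{F}$ with $A\subseteq A'$. A set $U\subseteq\omega^\omega\times Z$ is universal for $\mathcal{I}$ if $U_x\in\mathcal{I}$ for all $x\in\omega^\omega$ and the family of vertical sections $\{U_x:x\in\omega^\omega\}$ is a base of $\mathcal{I}$. *)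

theory Defs
  imports "HOL-Probability.Probability"
begin

text \<open>
  \<open>nat \<Rightarrow> bool\<close> and \<open>nat \<Rightarrow> nat\<close> carry the product topology of the discrete factors,
  so they are the Cantor space and the Baire space.
\<close>

definition nowhere_dense :: "'a::topological_space set \<Rightarrow> bool" where
  "nowhere_dense A \<longleftrightarrow> interior (closure A) = {}"

definition meager_ideal :: "'a::topological_space set set" where
  "meager_ideal = {A. \<exists>F :: nat \<Rightarrow> 'a set. (\<forall>n. nowhere_dense (F n)) \<and> A = (\<Union>n. F n)}"

definition cantor_measure :: "(nat \<Rightarrow> bool) measure" where
  "cantor_measure = (\<Pi>\<^sub>M i\<in>(UNIV :: nat set). uniform_count_measure (UNIV :: bool set))"

text \<open>
  The completion makes every subset of a measurable null set a null set, so this is the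
  ideal of all null sets and not only of the Borel ones.
\<close>

definition null_ideal :: "'a measure \<Rightarrow> 'a set set" where
  "null_ideal M = null_sets (completion M)"

text \<open>The vertical section of \<open>B\<close> at \<open>x\<close> is the relational image \<open>B `` {x}\<close>.\<close>

definition fubini_product ::
    "'a::topological_space set set \<Rightarrow> 'b::topological_space set set \<Rightarrow> ('a \<times> 'b) set set" where
  "fubini_product I J =
    {A. \<exists>B. B \<in> sets (borel :: ('a \<times> 'b) measure) \<and> A \<subseteq> B \<and> {x. B `` {x} \<notin> J} \<in> I}"

definition base_of_ideal :: "'z set set \<Rightarrow> 'z set set \<Rightarrow> bool" where
  "base_of_ideal F I \<longleftrightarrow> F \<subseteq> I \<and> (\<forall>A\<in>I. \<exists>A'\<in>F. A \<subseteq> A')"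

definition universal_for :: "((nat \<Rightarrow> nat) \<times> 'z) set \<Rightarrow> 'z set set \<Rightarrow> bool" where
  "universal_for U I \<longleftrightarrow> (\<forall>x. U `` {x} \<in> I) \<and> base_of_ideal (range (\<lambda>x. U `` {x})) I"

text \<open>The class \<open>\<Pi>\<^sup>0\<^sub>2\<close> of the Borel hierarchy is \<^const>\<open>gdelta\<close>.\<close>

definition Sigma03 :: "'a::topological_space set \<Rightarrow> bool" where
  "Sigma03 A \<longleftrightarrow> (\<exists>G :: nat \<Rightarrow> 'a set. (\<forall>n. gdelta (G n)) \<and> A = (\<Union>n. G n))"

end

theory Submission
  imports Defs
begin

text \<open>
  Null sets and meager sets have bases that are described by sequences of open sets: a null set
  is covered by \<open>\<Inter>k. G k\<close> with \<open>G k\<close> open of measure at most \<open>2\<^bsup>-k\<^esup>\<close>, and a meager set by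
  \<open>\<Union>k. - D k\<close> with \<open>D k\<close> open and dense. All sequences of open sets occur as the sections of one
  sequence of open sets over the Baire space (\<open>universal_open_sequences\<close>). Its sections need not
  have small measure, or be dense, but these requirements are closed, respectively \<open>G\<^sub>\<delta>\<close>, in the
  parameter, and can be made part of the universal set without leaving \<open>\<Sigma>\<^sup>0\<^sub>3\<close>. This gives the sets
  \<open>null_part\<close> and \<open>meager_part\<close>, all of whose sections are null, respectively meager.

  For a Fubini product of the two ideals, one such set with parameter \<open>\<alpha>\<close> covers the exceptional
  points of the first coordinate, and another one with parameter \<open>(\<alpha>, x)\<close> covers the sections over
  the points \<open>x\<close> that remain; the universal set is the union of both, and its sections belong to
  the Fubini product by construction (\<open>universal_for_fubini_productI\<close>).

  What has to be proved is that every member \<open>B\<close> of the product, which may be taken to be Borel, is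
  covered in this way. The open sets that cover the sections of \<open>B\<close> must therefore be chosen
  simultaneously for all \<open>x\<close>, as sections of open subsets of the product, up to a set of \<open>x\<close> that is
  small in the sense of the first ideal. If the sections are null, this is
  \<open>borel_open_cover_mod_meager\<close>: outside a meager set of \<open>x\<close>, a Borel set has outer approximations
  in measure by open subsets of the product, since a Borel dependence on \<open>x\<close> is, up to a meager set,
  constant on open sets. If the sections are meager, it is \<open>borel_open_sections_mod_null\<close>: outside
  a set of small measure, the sections of a Borel set equal those of an open set up to countably
  many closed sets with nowhere dense sections, since by outer regularity a Borel dependence on
  \<open>x\<close> becomes open on a large set. The Baire category theorem then shows that the open set has
  empty sections wherever those of \<open>B\<close> are meager.

  The argument works for arbitrary Polish spaces and sigma-finite Borel measures; the Cantor
  space and the real line are instances.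
\<close>

section \<open>The discrete spaces as Polish spaces\<close>

lemma discrete_metric_open_uniformity:
  fixes U :: "'a::discrete_topology set" and d :: "'a \<Rightarrow> 'a \<Rightarrow> real"
  assumes d: "\<And>x y. d x y = of_bool (x \<noteq> y)"
  shows "open U \<longleftrightarrow>
    (\<forall>x\<in>U. \<forall>\<^sub>F (x', y) in (INF e\<in>{0<..}. principal {(x, y). d x y < e}). x' = x \<longrightarrow> y \<in> U)"
proof -
  have "\<forall>\<^sub>F (x', y) in (INF e\<in>{0<..}. principal {(x, y). d x y < e}). x' = x \<longrightarrow> y \<in> U"
    if "x \<in> U" for x
    using that d
    by (auto intro!: eventually_INF1[of 1] simp: eventually_principal split: if_splits)
  then show ?thesis
    by (simp add: Topological_Spaces.open_discrete)
qed

text \<open>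
  With the discrete metric on the factors, the Cantor space and the Baire space become Polish
  spaces through the metric on countable products, and the arguments below can be
  carried out for arbitrary Polish spaces. The metric induces the topology that \<^typ>\<open>bool\<close> and
  \<^typ>\<open>nat\<close> already carry, so no topological notion changes its meaning.
\<close>

instantiation bool :: metric_space
begin

definition dist_bool :: "bool \<Rightarrow> bool \<Rightarrow> real" where
  "dist_bool x y = of_bool (x \<noteq> y)"

definition uniformity_bool :: "(bool \<times> bool) filter" where
  "uniformity_bool = (INF e\<in>{0<..}. principal {(x, y). dist x y < e})"

instance
proof
  show "open U \<longleftrightarrow> (\<forall>x\<in>U. \<forall>\<^sub>F (x', y) in uniformity. x' = x \<longrightarrow> y \<in> U)"
    for U :: "bool set"
    unfolding uniformity_bool_def by (rule discrete_metric_open_uniformity) (rule dist_bool_def)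
qed (rule uniformity_bool_def, auto simp: dist_bool_def of_bool_def)

end

instantiation nat :: metric_space
begin

definition dist_nat :: "nat \<Rightarrow> nat \<Rightarrow> real" where
  "dist_nat x y = of_bool (x \<noteq> y)"

definition uniformity_nat :: "(nat \<times> nat) filter" where
  "uniformity_nat = (INF e\<in>{0<..}. principal {(x, y). dist x y < e})"

instance
proof
  show "open U \<longleftrightarrow> (\<forall>x\<in>U. \<forall>\<^sub>F (x', y) in uniformity. x' = x \<longrightarrow> y \<in> U)"
    for U :: "nat set"
    unfolding uniformity_nat_def by (rule discrete_metric_open_uniformity) (rule dist_nat_def)
qed (rule uniformity_nat_def, auto simp: dist_nat_def of_bool_def)

end

lemma discrete_metric_Cauchy_convergent:
  fixes X :: "nat \<Rightarrow> 'a::metric_space"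
  assumes d: "\<And>x y :: 'a. dist x y = of_bool (x \<noteq> y)" and "Cauchy X"
  shows "convergent X"
proof -
  obtain N where N: "dist (X m) (X n) < 1" if "m \<ge> N" "n \<ge> N" for m n
    using metric_CauchyD[OF \<open>Cauchy X\<close>, of 1] by auto
  have "X n = X N" if "n \<ge> N" for n
  proof (rule ccontr)
    assume "X n \<noteq> X N"
    then have "dist (X n) (X N) = 1" by (subst d) simp
    with N[of n N] that show False by simp
  qed
  then have "X \<longlonglongrightarrow> X N"
    by (intro tendsto_eventually eventually_sequentiallyI)
  then show ?thesis
    by (rule convergentI)
qed

instance bool :: polish_space
proof
  show "\<exists>B :: bool set set. countable B \<and> open = generate_topology B"
  proof (intro exI conjI ext iffI)
    show "countable (UNIV :: bool set set)" by (rule countable_finite) (rule finite)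
    show "generate_topology UNIV S" for S :: "bool set"
      by (rule generate_topology.Basis) (rule UNIV_I)
    show "open S" for S :: "bool set"
      by (rule Topological_Spaces.open_discrete)
  qed
qed (rule discrete_metric_Cauchy_convergent, rule dist_bool_def)

instance nat :: polish_space
  by standard (rule discrete_metric_Cauchy_convergent, rule dist_nat_def)

section \<open>Countable bases and the low Borel classes\<close>

text \<open>
  The empty set is put into the enumeration so that every open set, the empty one included, is
  a union of a sequence of members.
\<close>

lemma countable_basis_sequence:
  obtains b :: "nat \<Rightarrow> 'a::second_countable_topology set"
  where "\<And>n. open (b n)" "{} \<in> range b"
    "\<And>S x. open S \<Longrightarrow> x \<in> S \<Longrightarrow> \<exists>n. x \<in> b n \<and> b n \<subseteq> S"
proof -
  obtain B :: "'a set set" where B: "countable B" "topological_basis B"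
    using ex_countable_basis by blast
  define b where "b = from_nat_into (insert {} B)"
  have r: "range b = insert {} B"
    unfolding b_def using B(1) by (intro range_from_nat_into) auto
  show ?thesis
  proof (rule that[of b])
    show "open (b n)" for n
      using r topological_basis_open[OF B(2)] open_empty by (metis insertE rangeI)
    show "\<exists>n. x \<in> b n \<and> b n \<subseteq> S" if "open S" "x \<in> S" for S x
      using topological_basisE[OF B(2) that] r by (metis insertCI rangeE)
  qed (simp add: r)
qed

lemma open_eq_UN_rectangles:
  fixes W :: "('a::second_countable_topology \<times> 'b::second_countable_topology) set"
  assumes "open W"
  obtains A B where "\<And>n::nat. open (A n :: 'a set)" "\<And>n. open (B n :: 'b set)"
    "W = (\<Union>n. A n \<times> B n)"
proof -
  obtain a :: "nat \<Rightarrow> 'a set" where a: "\<And>n. open (a n)" "{} \<in> range a"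
      "\<And>S x. open S \<Longrightarrow> x \<in> S \<Longrightarrow> \<exists>n. x \<in> a n \<and> a n \<subseteq> S"
    using countable_basis_sequence by blast
  obtain b :: "nat \<Rightarrow> 'b set" where b: "\<And>n. open (b n)" "{} \<in> range b"
      "\<And>S x. open S \<Longrightarrow> x \<in> S \<Longrightarrow> \<exists>n. x \<in> b n \<and> b n \<subseteq> S"
    using countable_basis_sequence by blast
  define A where "A m = (if a (fst (prod_decode m)) \<times> b (snd (prod_decode m)) \<subseteq> W
    then a (fst (prod_decode m)) else {})" for m
  define B where "B m = b (snd (prod_decode m))" for m
  have "(x, y) \<in> (\<Union>n. A n \<times> B n)" if "(x, y) \<in> W" for x y
  proof -
    obtain S T where ST: "open S" "open T" "(x, y) \<in> S \<times> T" "S \<times> T \<subseteq> W"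
      using open_prod_elim[OF assms \<open>(x, y) \<in> W\<close>] by blast
    obtain i where i: "x \<in> a i" "a i \<subseteq> S" using a(3)[of S x] ST by auto
    obtain j where j: "y \<in> b j" "b j \<subseteq> T" using b(3)[of T y] ST by auto
    have "a i \<times> b j \<subseteq> W" using i j ST(4) by blast
    then have "(x, y) \<in> A (prod_encode (i, j)) \<times> B (prod_encode (i, j))"
      using i j by (simp add: A_def B_def)
    then show ?thesis by blast
  qed
  moreover have "A n \<times> B n \<subseteq> W" for n
    by (auto simp: A_def B_def)
  ultimately have "W = (\<Union>n. A n \<times> B n)"
    by (intro equalityI subrelI) blast+
  moreover have "open (A n)" "open (B n)" for n
    using a(1) b(1) by (simp_all add: A_def B_def)
  ultimately show ?thesis
    using that by blast
qed

lemma open_imp_gdelta: "open S \<Longrightarrow> gdelta S"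
  using gdelta.intros[of "\<lambda>_. S"] by simp

lemma gdelta_INT:
  assumes "\<And>n::nat. gdelta (G n)"
  shows "gdelta (\<Inter>n. G n)"
proof -
  have "\<forall>n. \<exists>F::nat \<Rightarrow> _. (\<forall>m. open (F m)) \<and> G n = (\<Inter>m. F m)"
    using assms by (metis gdelta.cases)
  then obtain F where F: "\<And>n m::nat. open (F n m)" "\<And>n. G n = (\<Inter>m. F n m)"
    by metis
  have "(\<Inter>n. G n) = (\<Inter>p. case p of (n, m) \<Rightarrow> F n m)"
    unfolding F(2) by auto
  also have "\<dots> = (\<Inter>k. (case prod_decode k of (n, m) \<Rightarrow> F n m))"
    using surj_prod_decode by (metis (no_types) image_image)
  finally have "(\<Inter>n. G n) = (\<Inter>k. (case prod_decode k of (n, m) \<Rightarrow> F n m))" .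
  moreover have "gdelta (\<Inter>k. (case prod_decode k of (n, m) \<Rightarrow> F n m))"
    by (intro gdelta.intros) (simp add: F(1) split: prod.splits)
  ultimately show ?thesis by simp
qed

lemma gdelta_Int:
  assumes "gdelta S" "gdelta T"
  shows "gdelta (S \<inter> T)"
proof -
  have "S \<inter> T = (\<Inter>n::nat. if n = 0 then S else T)" by (auto split: if_splits)
  with assms gdelta_INT[of "\<lambda>n. if n = 0 then S else T"] show ?thesis by simp
qed

lemma gdelta_vimage:
  assumes "continuous_on UNIV f" "gdelta S"
  shows "gdelta (f -` S)"
  using assms(2)
proof cases
  case (1 F)
  have "gdelta (\<Inter>n. f -` F n)"
    by (intro gdelta.intros open_vimage 1 assms(1))
  with 1 show ?thesis by (simp add: vimage_INT)
qed

lemma closed_imp_gdelta: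
  fixes S :: "'a::metric_space set"
  assumes "closed S"
  shows "gdelta S"
proof (cases "S = {}")
  case False
  have "S = (\<Inter>n. {x. infdist x S < inverse (real (Suc n))})"
  proof (intro equalityI subsetI)
    fix x assume "x \<in> (\<Inter>n. {x. infdist x S < inverse (real (Suc n))})"
    then have "infdist x S < inverse (real (Suc n))" for n by blast
    then have "infdist x S = 0"
      using infdist_nonneg[of x S] reals_Archimedean[of "infdist x S"] 
      by (metis less_asym' linorder_neqE_linordered_idom not_less)
    then show "x \<in> S" using in_closed_iff_infdist_zero[OF assms False] by simp
  qed auto
  moreover have "open {x. infdist x S < r}" for r
    by (intro open_Collect_less continuous_intros)
  ultimately show ?thesis
    using gdelta.intros[of "\<lambda>n. {x. infdist x S < inverse (real (Suc n))}"] by simp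
qed (simp add: open_imp_gdelta)

lemma gdelta_imp_Sigma03: "gdelta S \<Longrightarrow> Sigma03 S"
  unfolding Sigma03_def by (intro exI[of _ "\<lambda>_. S"]) auto

lemma Sigma03_UN:
  assumes "\<And>n::nat. Sigma03 (S n)"
  shows "Sigma03 (\<Union>n. S n)"
proof -
  obtain G where G: "\<And>n m::nat. gdelta (G n m)" "\<And>n. S n = (\<Union>m. G n m)"
    using assms unfolding Sigma03_def by metis
  have "(\<Union>n. S n) = (\<Union>p. case p of (n, m) \<Rightarrow> G n m)"
    unfolding G(2) by auto
  also have "\<dots> = (\<Union>k. (case prod_decode k of (n, m) \<Rightarrow> G n m))"
    using surj_prod_decode by (metis (no_types) image_image)
  finally have "(\<Union>n. S n) = (\<Union>k. (case prod_decode k of (n, m) \<Rightarrow> G n m))" .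
  moreover have "gdelta (case prod_decode k of (n, m) \<Rightarrow> G n m)" for k
    by (simp add: G(1) split: prod.splits)
  ultimately show ?thesis
    unfolding Sigma03_def
    by (intro exI[of _ "\<lambda>k. case prod_decode k of (n, m) \<Rightarrow> G n m"]) simp
qed

lemma Sigma03_Un:
  assumes "Sigma03 S" "Sigma03 T"
  shows "Sigma03 (S \<union> T)"
proof -
  have "S \<union> T = (\<Union>n::nat. if n = 0 then S else T)" by (auto split: if_splits)
  with assms Sigma03_UN[of "\<lambda>n. if n = 0 then S else T"] show ?thesis by simp
qed

text \<open>
  Every set below is assembled from few pieces by rearranging and projecting coordinates, so
  closure under continuous preimages is what transports the class.
\<close>

lemma Sigma03_vimage:
  assumes "continuous_on UNIV f" "Sigma03 S"
  shows "Sigma03 (f -` S)"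
  using assms unfolding Sigma03_def by (metis gdelta_vimage vimage_UN)

lemma Sigma03_imp_borel:
  assumes "Sigma03 S"
  shows "S \<in> sets borel"
proof -
  have "G \<in> sets borel" if "gdelta G" for G :: "'a set"
    using that by cases (auto intro!: sets.countable_INT'')
  with assms show ?thesis
    unfolding Sigma03_def by auto
qed

lemma open_eq_UN_enumeration:
  fixes c :: "nat \<Rightarrow> 'a::topological_space set"
  assumes "{} \<in> range c" "open S"
    and basis: "\<And>S x. open S \<Longrightarrow> x \<in> S \<Longrightarrow> \<exists>n. x \<in> c n \<and> c n \<subseteq> S"
  shows "\<exists>f :: nat \<Rightarrow> nat. S = (\<Union>n. c (f n))"
proof -
  obtain z where z: "c z = {}" using \<open>{} \<in> range c\<close> by (metis imageE)
  have "(\<Union>n. c (if c n \<subseteq> S then n else z)) \<subseteq> S"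
    using z by (auto split: if_splits)
  moreover have "S \<subseteq> (\<Union>n. c (if c n \<subseteq> S then n else z))"
  proof
    fix x assume "x \<in> S"
    then obtain n where "x \<in> c n" "c n \<subseteq> S" using basis[OF \<open>open S\<close>] by blast
    then show "x \<in> (\<Union>n. c (if c n \<subseteq> S then n else z))" by (intro UN_I[of n]) auto
  qed
  ultimately have "S = (\<Union>n. c (if c n \<subseteq> S then n else z))" by (rule subset_antisym[rotated])
  then show ?thesis by (intro exI[of _ "\<lambda>n. if c n \<subseteq> S then n else z"])
qed

lemma open_UN_coded:
  fixes c :: "nat \<Rightarrow> 'a::topological_space set"
  assumes "\<And>n. open (c n)"
  shows "open {(\<alpha> :: nat \<Rightarrow> nat, x). \<exists>n. x \<in> c (\<alpha> (i n))}"
proof -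
  have "open ((\<lambda>\<alpha>. \<alpha> (i n)) -` {m} :: (nat \<Rightarrow> nat) set)" for n m
    by (intro open_vimage Topological_Spaces.open_discrete continuous_on_product_coordinates)
  then have "open (\<Union>n. \<Union>m. ((\<lambda>\<alpha>. \<alpha> (i n)) -` {m}) \<times> c m)"
    using assms by (intro open_UN ballI open_Times) auto
  moreover have "{(\<alpha> :: nat \<Rightarrow> nat, x). \<exists>n. x \<in> c (\<alpha> (i n))}
      = (\<Union>n. \<Union>m. ((\<lambda>\<alpha>. \<alpha> (i n)) -` {m}) \<times> c m)"
    by auto
  ultimately show ?thesis by simp
qed

text \<open>
  A point of the Baire space enumerates basic open sets; the union of an enumerated subfamily is
  open jointly in the code and the point, because finitely many values of the code decide
  membership. One code carries two sequences of open sets, in two spaces: the values at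
  \<open>prod_encode (i, n)\<close> serve the first space for even \<open>i\<close> and the second one for odd \<open>i\<close>.
\<close>

lemma universal_open_sequences:
  obtains W1 :: "nat \<Rightarrow> ((nat \<Rightarrow> nat) \<times> 'a::second_countable_topology) set"
      and W2 :: "nat \<Rightarrow> ((nat \<Rightarrow> nat) \<times> 'b::second_countable_topology) set"
  where "\<forall>k. open (W1 k)" "\<forall>k. open (W2 k)"
    "\<forall>G1 G2. (\<forall>k. open (G1 k)) \<and> (\<forall>k. open (G2 k)) \<longrightarrow>
      (\<exists>\<alpha>. \<forall>k. W1 k `` {\<alpha>} = G1 k \<and> W2 k `` {\<alpha>} = G2 k)"
proof -
  obtain a :: "nat \<Rightarrow> 'a set" where a: "\<And>n. open (a n)" "{} \<in> range a"
      "\<And>S x. open S \<Longrightarrow> x \<in> S \<Longrightarrow> \<exists>n. x \<in> a n \<and> a n \<subseteq> S"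
    using countable_basis_sequence by blast
  obtain b :: "nat \<Rightarrow> 'b set" where b: "\<And>n. open (b n)" "{} \<in> range b"
      "\<And>S x. open S \<Longrightarrow> x \<in> S \<Longrightarrow> \<exists>n. x \<in> b n \<and> b n \<subseteq> S"
    using countable_basis_sequence by blast
  define W1 where "W1 k = {(\<alpha>, x). \<exists>n. x \<in> a (\<alpha> (prod_encode (2 * k, n)))}" for k
  define W2 where "W2 k = {(\<alpha>, x). \<exists>n. x \<in> b (\<alpha> (prod_encode (2 * k + 1, n)))}" for k
  show ?thesis
  proof (rule that[of W1 W2])
    show "\<forall>k. open (W1 k)" "\<forall>k. open (W2 k)"
      unfolding W1_def W2_def by (intro allI open_UN_coded a(1) b(1))+
    show "\<forall>G1 G2. (\<forall>k. open (G1 k)) \<and> (\<forall>k. open (G2 k)) \<longrightarrow>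
      (\<exists>\<alpha>. \<forall>k. W1 k `` {\<alpha>} = G1 k \<and> W2 k `` {\<alpha>} = G2 k)"
    proof (intro allI impI)
      fix G1 :: "nat \<Rightarrow> 'a set" and G2 :: "nat \<Rightarrow> 'b set"
      assume G': "(\<forall>k. open (G1 k)) \<and> (\<forall>k. open (G2 k))"
      then have G: "open (G1 k)" "open (G2 k)" for k by simp_all
    have "\<forall>k. \<exists>f :: nat \<Rightarrow> nat. G1 k = (\<Union>n. a (f n))"
      by (intro allI, rule open_eq_UN_enumeration) (fact a(2), fact G(1), fact a(3))
    then obtain f where f: "\<And>k. G1 k = (\<Union>n::nat. a (f k n))"
      by (auto dest: choice)
    have "\<forall>k. \<exists>f :: nat \<Rightarrow> nat. G2 k = (\<Union>n. b (f n))"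
      by (intro allI, rule open_eq_UN_enumeration) (fact b(2), fact G(2), fact b(3))
    then obtain g where g: "\<And>k. G2 k = (\<Union>n::nat. b (g k n))"
      by (auto dest: choice)
    define \<alpha> where "\<alpha> m = (case prod_decode m of (i, n) \<Rightarrow>
      if even i then f (i div 2) n else g (i div 2) n)" for m
    have "W1 k `` {\<alpha>} = G1 k \<and> W2 k `` {\<alpha>} = G2 k" for k
      by (auto simp: W1_def W2_def f g \<alpha>_def)
    then show "\<exists>\<alpha>. \<forall>k. W1 k `` {\<alpha>} = G1 k \<and> W2 k `` {\<alpha>} = G2 k"
      by blast
    qed
  qed
qed

section \<open>Meager sets and the property of Baire\<close>

text \<open>
  Meager sets are handled through dense open sets only: these are what a code can describe, and
  the closures in the definition need not be mentioned again.
\<close>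

lemma meager_ideal_iff:
  "A \<in> meager_ideal \<longleftrightarrow>
    (\<exists>D :: nat \<Rightarrow> 'a::topological_space set.
      (\<forall>n. open (D n) \<and> closure (D n) = UNIV) \<and> A \<subseteq> (\<Union>n. - D n))"
proof
  assume "A \<in> meager_ideal"
  then obtain F :: "nat \<Rightarrow> 'a set" where F: "\<And>n. interior (closure (F n)) = {}" "A = (\<Union>n. F n)"
    unfolding meager_ideal_def nowhere_dense_def by blast
  have "closure (- closure (F n)) = UNIV" for n
    using F(1)[of n] by (simp add: closure_complement)
  moreover have "F n \<subseteq> - (- closure (F n))" for n
    using closure_subset by auto
  ultimately show "\<exists>D :: nat \<Rightarrow> 'a set.
      (\<forall>n. open (D n) \<and> closure (D n) = UNIV) \<and> A \<subseteq> (\<Union>n. - D n)"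
    using F(2) by (intro exI[of _ "\<lambda>n. - closure (F n)"]) (simp, blast)
next
  assume "\<exists>D :: nat \<Rightarrow> 'a set. (\<forall>n. open (D n) \<and> closure (D n) = UNIV) \<and> A \<subseteq> (\<Union>n. - D n)"
  then obtain D :: "nat \<Rightarrow> 'a set"
    where D: "\<And>n. open (D n)" "\<And>n. closure (D n) = UNIV" "A \<subseteq> (\<Union>n. - D n)" by blast
  have "nowhere_dense (A \<inter> - D n)" for n
  proof -
    have "closure (A \<inter> - D n) \<subseteq> - D n"
      using D(1) by (intro closure_minimal) (auto simp: closed_Compl)
    then have "interior (closure (A \<inter> - D n)) \<subseteq> interior (- D n)"
      by (rule interior_mono)
    then show ?thesis using D(2)[of n] by (simp add: nowhere_dense_def interior_complement)
  qed
  moreover have "A = (\<Union>n. A \<inter> - D n)" using D(3) by blast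
  ultimately show "A \<in> meager_ideal"
    unfolding meager_ideal_def by (intro CollectI exI[of _ "\<lambda>n. A \<inter> - D n"] conjI allI)
qed

lemma meager_subset: "A \<in> meager_ideal \<Longrightarrow> B \<subseteq> A \<Longrightarrow> B \<in> meager_ideal"
  unfolding meager_ideal_iff by (meson subset_trans)

lemma meager_UN:
  assumes "\<And>n::nat. A n \<in> meager_ideal"
  shows "(\<Union>n. A n) \<in> meager_ideal"
proof -
  obtain D where D: "\<And>n m::nat. open (D n m) \<and> closure (D n m) = UNIV" "\<And>n. A n \<subseteq> (\<Union>m. - D n m)"
    using assms unfolding meager_ideal_iff by metis
  have "(\<Union>n. A n) \<subseteq> (\<Union>k. - (case prod_decode k of (n, m) \<Rightarrow> D n m))"
  proof
    fix x assume "x \<in> (\<Union>n. A n)"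
    then obtain n m where "x \<in> - D n m" using D(2) by blast
    then show "x \<in> (\<Union>k. - (case prod_decode k of (n, m) \<Rightarrow> D n m))"
      by (intro UN_I[of "prod_encode (n, m)"]) auto
  qed
  then show ?thesis
    unfolding meager_ideal_iff using D(1)
    by (intro exI[of _ "\<lambda>k. (case prod_decode k of (n, m) \<Rightarrow> D n m)"])
      (auto split: prod.splits)
qed

lemma meager_Un:
  assumes "A \<in> meager_ideal" "B \<in> meager_ideal"
  shows "A \<union> B \<in> meager_ideal"
proof -
  have "A \<union> B = (\<Union>n::nat. if n = 0 then A else B)" by (auto split: if_splits)
  with assms meager_UN[of "\<lambda>n. if n = 0 then A else B"] show ?thesis by simp
qed

lemma Compl_dense_open_meager:
  "open D \<Longrightarrow> closure D = UNIV \<Longrightarrow> - D \<in> meager_ideal"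
  unfolding meager_ideal_iff by (intro exI[of _ "\<lambda>_. D"]) auto

text \<open>
  This is the Baire category theorem.
\<close>

lemma open_meager_empty:
  fixes U :: "'a::complete_space set"
  assumes "open U" "U \<in> meager_ideal"
  shows "U = {}"
proof -
  obtain D :: "nat \<Rightarrow> 'a set"
    where D: "\<And>n. open (D n)" "\<And>n. closure (D n) = UNIV" "U \<subseteq> (\<Union>n. - D n)"
    using assms(2) unfolding meager_ideal_iff by blast
  have "interior (\<Union>(range (\<lambda>n. - D n))) = {}"
    using Baire_category_alt[of euclidean "range (\<lambda>n. - D n)"] D(1,2)
    by (force simp: completely_metrizable_space_euclidean interior_complement closed_Compl)
  moreover have "U \<subseteq> interior (\<Union>(range (\<lambda>n. - D n)))"
    using assms(1) D(3) by (rule interior_maximal[rotated])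
  ultimately show ?thesis by blast
qed

lemma borel_property_of_Baire:
  fixes S :: "'a::topological_space set"
  assumes "S \<in> sets borel"
  shows "\<exists>O'. open O' \<and> sym_diff S O' \<in> meager_ideal"
proof -
  have "S \<in> sigma_sets UNIV {S. open S}" using assms by (simp add: borel_def)
  then show ?thesis
  proof induct
    case (Basic a)
    then show ?case
      by (intro exI[of _ a]) (auto intro: meager_subset[OF Compl_dense_open_meager[of UNIV]])
  next
    case Empty
    show ?case
      by (intro exI[of _ "{}"]) (auto intro: meager_subset[OF Compl_dense_open_meager[of UNIV]])
  next
    case (Compl a)
    then obtain P where P: "open P" "sym_diff a P \<in> meager_ideal" by blast
    \<comment> \<open>The open set for the complement is the exterior of \<open>P\<close>; the boundary of \<open>P\<close> is nowhere dense.\<close>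
    define D where "D = P \<union> interior (- P)"
    have "open D" unfolding D_def using P(1) by auto
    moreover have "closure D = UNIV"
      unfolding D_def interior_complement using closure_subset[of "- closure P"]
      by (auto simp: closure_Un)
    ultimately have "- D \<in> meager_ideal" by (rule Compl_dense_open_meager)
    then have "sym_diff a P \<union> - D \<in> meager_ideal" by (rule meager_Un[OF P(2)])
    moreover have "sym_diff (UNIV - a) (interior (- P)) \<subseteq> sym_diff a P \<union> - D"
      using interior_subset[of "- P"] unfolding D_def by auto
    ultimately have "sym_diff (UNIV - a) (interior (- P)) \<in> meager_ideal"
      by (rule meager_subset)
    then show ?case by (intro exI[of _ "interior (- P)"] conjI open_interior)
  next
    case (Union a)
    then obtain P where P: "\<And>n::nat. open (P n) \<and> sym_diff (a n) (P n) \<in> meager_ideal" by metis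
    have "sym_diff (\<Union>n. a n) (\<Union>n. P n) \<subseteq> (\<Union>n. sym_diff (a n) (P n))" by blast
    then have "sym_diff (\<Union>n. a n) (\<Union>n. P n) \<in> meager_ideal"
      by (rule meager_subset[OF meager_UN, rotated]) (rule conjunct2[OF P])
    then show ?case
      using P by (intro exI[of _ "\<Union>n. P n"] conjI open_UN) auto
  qed
qed

section \<open>Null sets\<close>

lemma null_ideal_iff: "A \<in> null_ideal M \<longleftrightarrow> (\<exists>N\<in>null_sets M. A \<subseteq> N)"
  unfolding null_ideal_def by (rule null_sets_completion_iff2)

lemma null_ideal_subset: "A \<in> null_ideal M \<Longrightarrow> B \<subseteq> A \<Longrightarrow> B \<in> null_ideal M"
  unfolding null_ideal_iff by (meson subset_trans)

lemma null_ideal_cong: "null_sets M = null_sets N \<Longrightarrow> null_ideal M = null_ideal N"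
  by (auto simp: null_ideal_iff)

lemma ennreal_half_power: "(1 / 2 :: ennreal) ^ k = ennreal ((1 / 2) ^ k)"
proof -
  have "ennreal (1 / 2) = ennreal 1 / ennreal 2" by (rule divide_ennreal[symmetric]) simp_all
  then show ?thesis by (simp add: ennreal_power[symmetric])
qed

lemma ennreal_le_half_powers_imp_zero:
  fixes x :: ennreal
  assumes "\<And>k. x \<le> (1 / 2) ^ k"
  shows "x = 0"
proof -
  have "(\<lambda>k. (1 / 2 :: ennreal) ^ k) \<longlonglongrightarrow> ennreal 0"
    unfolding ennreal_half_power by (intro tendsto_ennrealI LIMSEQ_realpow_zero) auto
  then show ?thesis
    using LIMSEQ_le_const[of "\<lambda>k. (1 / 2 :: ennreal) ^ k" 0 x] assms by auto
qed

lemma suminf_half_powers_ennreal: "(\<Sum>n. e * (1 / 2 :: ennreal) ^ Suc n) = e"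
proof -
  have "(\<Sum>n. (1 / 2 :: ennreal) ^ Suc n) = 1"
    unfolding ennreal_half_power
    by (subst suminf_ennreal_eq[OF _ power_half_series]) auto
  then show ?thesis by (simp add: ennreal_suminf_cmult del: power_Suc)
qed

lemma emeasure_UN_le_half_powers:
  assumes "\<And>n::nat. A n \<in> sets M" "\<And>n. emeasure M (A n) \<le> e * (1 / 2) ^ Suc n"
  shows "emeasure M (\<Union>n. A n) \<le> e"
proof -
  have "emeasure M (\<Union>n. A n) \<le> (\<Sum>n. emeasure M (A n))"
    using assms(1) by (intro emeasure_subadditive_countably) auto
  also have "\<dots> \<le> (\<Sum>n. e * (1 / 2) ^ Suc n)"
    using assms(2) by (intro suminf_le) auto
  finally show ?thesis by (simp only: suminf_half_powers_ennreal)
qed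

lemma outer_regular_Diff:
  fixes M :: "'a::polish_space measure"
  assumes "finite_measure M" "sets M = sets borel" "S \<in> sets borel" "e > 0"
  shows "\<exists>U. open U \<and> S \<subseteq> U \<and> emeasure M (U - S) \<le> e"
proof -
  interpret finite_measure M by fact
  have "emeasure M S = (INF U \<in> {U. S \<subseteq> U \<and> open U}. emeasure M U)"
    by (rule outer_regular[OF assms(2) _ assms(3)]) simp
  moreover have "emeasure M S < emeasure M S + e"
    using \<open>e > 0\<close> by (simp add: emeasure_finite ennreal_add_left_cancel_less less_top[symmetric])
  ultimately obtain U where U: "S \<subseteq> U" "open U" "emeasure M U < emeasure M S + e"
    by (auto simp: INF_less_iff)
  have "emeasure M (U - S) = emeasure M U - emeasure M S"
    using U assms by (intro emeasure_Diff) auto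
  also have "\<dots> \<le> e"
    using U(3) by (simp add: ennreal_minus_le_iff less_imp_le emeasure_finite add.commute)
  finally show ?thesis using U by blast
qed

lemma null_ideal_open_cover:
  fixes M :: "'a::polish_space measure"
  assumes "finite_measure M" "sets M = sets borel" "A \<in> null_ideal M"
  obtains G where "\<And>k::nat. open (G k)" "\<And>k. A \<subseteq> G k" "\<And>k. emeasure M (G k) \<le> (1 / 2) ^ k"
proof -
  obtain N where N: "N \<in> null_sets M" "A \<subseteq> N" using assms(3) by (auto simp: null_ideal_iff)
  have "\<exists>U. open U \<and> N \<subseteq> U \<and> emeasure M (U - N) \<le> (1 / 2) ^ k" for k :: nat
    using N(1) assms(2)
    by (intro outer_regular_Diff assms(1,2)) (auto simp: null_sets_def ennreal_half_power)
  then obtain U where U: "\<And>k::nat. open (U k)" "\<And>k. N \<subseteq> U k"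
      "\<And>k. emeasure M (U k - N) \<le> (1 / 2) ^ k" by metis
  have "emeasure M (U k) = emeasure M (U k - N)" for k
    using U(1) N(1) assms(2) by (intro emeasure_Diff_null_set[symmetric]) auto
  then show ?thesis using that[of U] U N(2) by fastforce
qed

text \<open>
  Only the null sets of the measure matter, so Lebesgue measure can be replaced by a finite
  measure with a positive density. Finiteness is needed for outer regularity and for continuity
  from above.
\<close>

lemma finite_borel_measure_same_null_ideal:
  fixes M :: "'a::topological_space measure"
  assumes "sigma_finite_measure M" "sets M = sets borel"
  obtains M' :: "'a measure"
  where "finite_measure M'" "sets M' = sets borel" "null_ideal M' = null_ideal M"
proof -
  interpret sigma_finite_measure M by fact
  obtain f :: "'a \<Rightarrow> real" where f: "f \<in> borel_measurable M" "\<And>x. f x > 0" "\<And>x. f x \<le> 1" "integrable M f"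
    by (rule obtain_positive_integrable_function) (rule that)
  define M' where "M' = density M f"
  have "emeasure M' (space M') = (\<integral>\<^sup>+ x. ennreal (f x) \<partial>M)"
    unfolding M'_def using f(1) by (subst emeasure_density) (auto intro!: nn_integral_cong)
  also have "\<dots> < \<infinity>"
    using f(4) f(2) by (simp add: nn_integral_eq_integral less_imp_le)
  finally have "finite_measure M'" by (intro finite_measureI) auto
  moreover have "null_sets M' = null_sets M"
  proof -
    have "\<not> ennreal (f x) = 0" for x
      using f(2)[of x] by (simp add: ennreal_eq_0_iff not_le)
    then show ?thesis
      using f(1) by (auto simp: M'_def null_sets_density_iff AE_iff_null_sets[symmetric] null_setsD2)
  qed
  then have "null_ideal M' = null_ideal M" by (rule null_ideal_cong)
  moreover have "sets M' = sets borel" using assms(2) by (simp add: M'_def)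
  ultimately show ?thesis using that by blast
qed

section \<open>Universal families of null sets and of meager sets\<close>

lemma Image_singleton_eq_vimage: "W `` {p} = Pair p -` W"
  by auto

lemma open_section:
  fixes W :: "('p::topological_space \<times> 'b::topological_space) set"
  assumes "open W"
  shows "open (W `` {p})"
  unfolding Image_singleton_eq_vimage
  by (intro open_vimage assms continuous_intros)

text \<open>
  The measure of the sections of an open set is lower semicontinuous: a lower bound for it is
  already reached by finitely many of the open rectangles that exhaust the set, and near \<open>p\<close> these
  rectangles remain present.
\<close>

lemma open_emeasure_section_greater:
  fixes W :: "('p::second_countable_topology \<times> 'b::second_countable_topology) set"
  assumes "open W" "sets M = sets borel"
  shows "open {p. c < emeasure M (W `` {p})}"
proof (subst open_subopen, intro ballI)
  fix p assume "p \<in> {p. c < emeasure M (W `` {p})}"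
  then have p: "c < emeasure M (W `` {p})" by simp
  obtain A B where AB: "\<And>n::nat. open (A n)" "\<And>n. open (B n)" "W = (\<Union>n. A n \<times> B n)"
    using open_eq_UN_rectangles[OF assms(1)] by blast
  define S where "S N = (\<Union>n\<in>{n. n < N \<and> p \<in> A n}. B n)" for N
  have "range S \<subseteq> sets M"
    using AB(2) assms(2) by (auto simp: S_def)
  moreover have "incseq S"
    by (rule incseq_SucI) (force simp: S_def less_Suc_eq)
  moreover have "(\<Union>N. S N) = W `` {p}"
    unfolding AB(3) S_def by auto
  ultimately have "(SUP N. emeasure M (S N)) = emeasure M (W `` {p})"
    using SUP_emeasure_incseq[of S M] by simp
  then obtain N where N: "c < emeasure M (S N)"
    using p by (metis less_SUP_iff)
  define T where "T = (\<Inter>n\<in>{n. n < N \<and> p \<in> A n}. A n)"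
  have "open T" unfolding T_def using AB(1) by (intro open_INT) auto
  moreover have "p \<in> T" by (simp add: T_def)
  moreover have "T \<subseteq> {p. c < emeasure M (W `` {p})}"
  proof
    fix q assume q: "q \<in> T"
    have "S N \<subseteq> W `` {q}" using q unfolding S_def T_def AB(3) by auto
    moreover have "W `` {q} \<in> sets M"
      using open_section[OF assms(1)] assms(2) by simp
    ultimately have "emeasure M (S N) \<le> emeasure M (W `` {q})" by (rule emeasure_mono)
    with N show "q \<in> {p. c < emeasure M (W `` {p})}" by simp
  qed
  ultimately show "\<exists>T. open T \<and> p \<in> T \<and> T \<subseteq> {p. c < emeasure M (W `` {p})}" by blast
qed

text \<open>
  Density of a section says that it meets each nonempty basic open set, and each of these
  conditions is the projection of an open set.
\<close>

lemma gdelta_dense_section: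
  fixes D :: "('p::metric_space \<times> 'b::second_countable_topology) set"
  assumes "open D"
  shows "gdelta {p. closure (D `` {p}) = UNIV}"
proof -
  obtain b :: "nat \<Rightarrow> 'b set" where b: "\<And>n. open (b n)" "{} \<in> range b"
      "\<And>S x. open S \<Longrightarrow> x \<in> S \<Longrightarrow> \<exists>n. x \<in> b n \<and> b n \<subseteq> S"
    using countable_basis_sequence by blast
  have dense: "closure (D `` {p}) = UNIV \<longleftrightarrow> (\<forall>n. b n \<noteq> {} \<longrightarrow> D `` {p} \<inter> b n \<noteq> {})" for p
  proof
    assume "closure (D `` {p}) = UNIV"
    then show "\<forall>n. b n \<noteq> {} \<longrightarrow> D `` {p} \<inter> b n \<noteq> {}"
      using b(1) by (metis Int_UNIV_left inf_commute open_Int_closure_eq_empty)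
  next
    assume *: "\<forall>n. b n \<noteq> {} \<longrightarrow> D `` {p} \<inter> b n \<noteq> {}"
    have "- closure (D `` {p}) = {}"
    proof (rule ccontr)
      assume "- closure (D `` {p}) \<noteq> {}"
      then obtain n where "b n \<noteq> {}" "b n \<subseteq> - closure (D `` {p})"
        using b(3)[of "- closure (D `` {p})"] by (metis closed_closure empty_iff ex_in_conv open_Compl)
      with * show False using closure_subset[of "D `` {p}"] by blast
    qed
    then show "closure (D `` {p}) = UNIV" by blast
  qed
  have "open (fst ` (D \<inter> UNIV \<times> b n))" for n
    using b(1) assms by (intro open_image_fst open_Int open_Times) auto
  then have "gdelta (if b n = {} then UNIV else fst ` (D \<inter> UNIV \<times> b n))" for n
    by (auto intro: open_imp_gdelta)
  then have "gdelta (\<Inter>n. if b n = {} then UNIV else fst ` (D \<inter> UNIV \<times> b n))"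
    by (rule gdelta_INT)
  moreover have "{p. closure (D `` {p}) = UNIV} =
      (\<Inter>n. if b n = {} then UNIV else fst ` (D \<inter> UNIV \<times> b n))"
  proof -
    have "p \<in> fst ` (D \<inter> UNIV \<times> b n) \<longleftrightarrow> D `` {p} \<inter> b n \<noteq> {}" for p n
      by force
    then have "p \<in> (if b n = {} then UNIV else fst ` (D \<inter> UNIV \<times> b n)) \<longleftrightarrow>
        (b n \<noteq> {} \<longrightarrow> D `` {p} \<inter> b n \<noteq> {})" for p n
      by (cases "b n = {}") simp_all
    then show ?thesis
      unfolding dense by (simp only: set_eq_iff mem_Collect_eq INT_iff ball_UNIV) simp
  qed
  ultimately show ?thesis by simp
qed

text \<open>
  For open sets \<open>W k\<close>, the section of \<open>null_part M W\<close> at \<open>p\<close> is the intersection of the sections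
  of the \<open>W k\<close> if these have measure at most \<open>2\<^bsup>-k\<^esup>\<close> for all \<open>k\<close>, and empty otherwise; the section
  of \<open>meager_part W\<close> is the union of the complements of those sections of the \<open>W k\<close> that are dense.
  The side conditions make every section small, whatever the open sets are. They are cheap: one is closed and
  the other is \<open>G\<^sub>\<delta>\<close> in \<open>p\<close>, so that the resulting sets are \<open>G\<^sub>\<delta>\<close> and \<open>\<Sigma>\<^sup>0\<^sub>3\<close>.
\<close>

definition null_part :: "'b measure \<Rightarrow> (nat \<Rightarrow> ('p \<times> 'b) set) \<Rightarrow> ('p \<times> 'b) set" where
  "null_part M W = {(p, y). \<forall>k. (p, y) \<in> W k \<and> emeasure M (W k `` {p}) \<le> (1 / 2) ^ k}"

definition meager_part :: "(nat \<Rightarrow> ('p \<times> 'b::topological_space) set) \<Rightarrow> ('p \<times> 'b) set" where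
  "meager_part W = {(p, y). \<exists>k. (p, y) \<notin> W k \<and> closure (W k `` {p}) = UNIV}"

lemma gdelta_null_part:
  fixes W :: "nat \<Rightarrow> ('p::{metric_space,second_countable_topology} \<times> 'b::polish_space) set"
  assumes "\<And>k. open (W k)" "sets M = sets borel"
  shows "gdelta (null_part M W)"
proof -
  have "closed {p. emeasure M (W k `` {p}) \<le> (1 / 2) ^ k}" for k
    using open_emeasure_section_greater[OF assms(1) assms(2), of "(1 / 2) ^ k" k]
    by (simp add: closed_def Collect_neg_eq[symmetric] not_le)
  then have "gdelta (W k \<inter> fst -` {p. emeasure M (W k `` {p}) \<le> (1 / 2) ^ k})" for k
    using assms(1) by (intro gdelta_Int open_imp_gdelta gdelta_vimage closed_imp_gdelta continuous_intros)
  then have "gdelta (\<Inter>k. W k \<inter> fst -` {p. emeasure M (W k `` {p}) \<le> (1 / 2) ^ k})"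
    by (rule gdelta_INT)
  moreover have "null_part M W = (\<Inter>k. W k \<inter> fst -` {p. emeasure M (W k `` {p}) \<le> (1 / 2) ^ k})"
    by (auto simp: null_part_def)
  ultimately show ?thesis by simp
qed

lemma Sigma03_meager_part:
  fixes W :: "nat \<Rightarrow> ('p::metric_space \<times> 'b::polish_space) set"
  assumes "\<And>k. open (W k)"
  shows "Sigma03 (meager_part W)"
proof -
  have "gdelta (- W k \<inter> fst -` {p. closure (W k `` {p}) = UNIV})" for k
    using assms
    by (intro gdelta_Int gdelta_vimage gdelta_dense_section closed_imp_gdelta closed_Compl continuous_intros)
  then have "Sigma03 (\<Union>k. - W k \<inter> fst -` {p. closure (W k `` {p}) = UNIV})"
    by (intro Sigma03_UN gdelta_imp_Sigma03)
  moreover have "meager_part W = (\<Union>k. - W k \<inter> fst -` {p. closure (W k `` {p}) = UNIV})"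
    by (auto simp: meager_part_def)
  ultimately show ?thesis by simp
qed

lemma null_part_section:
  fixes W :: "nat \<Rightarrow> ('p::topological_space \<times> 'b::topological_space) set"
  assumes "\<And>k. open (W k)" "sets M = sets borel"
  shows "null_part M W `` {p} \<in> null_ideal M"
proof (cases "\<forall>k. emeasure M (W k `` {p}) \<le> (1 / 2) ^ k")
  case True
  have S: "W k `` {p} \<in> sets M" for k
    using assms by (simp add: open_section)
  have "emeasure M (\<Inter>k. W k `` {p}) \<le> (1 / 2) ^ k" for k
    using emeasure_mono[of "\<Inter>k. W k `` {p}" "W k `` {p}" M] S True by (meson INT_lower UNIV_I order_trans)
  then have "emeasure M (\<Inter>k. W k `` {p}) = 0"
    by (rule ennreal_le_half_powers_imp_zero)
  then have "(\<Inter>k. W k `` {p}) \<in> null_sets M"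
    using S by (intro null_setsI sets.countable_INT') auto
  then show ?thesis
    by (rule null_ideal_iff[THEN iffD2, OF bexI, rotated]) (auto simp: null_part_def)
next
  case False
  then have "null_part M W `` {p} = {}" by (auto simp: null_part_def)
  then show ?thesis by (auto simp: null_ideal_iff)
qed

lemma meager_part_section:
  fixes W :: "nat \<Rightarrow> ('p::topological_space \<times> 'b::topological_space) set"
  assumes "\<And>k. open (W k)"
  shows "meager_part W `` {p} \<in> meager_ideal"
  unfolding meager_ideal_iff
  using assms
  by (intro exI[of _ "\<lambda>k. if closure (W k `` {p}) = UNIV then W k `` {p} else UNIV"])
    (auto simp: meager_part_def open_section)

lemma universal_forI:
  assumes "\<And>\<alpha>. U `` {\<alpha>} \<in> I" "\<And>A. A \<in> I \<Longrightarrow> \<exists>\<alpha>. A \<subseteq> U `` {\<alpha>}"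
  shows "universal_for U I"
  unfolding universal_for_def base_of_ideal_def
proof (intro conjI allI ballI image_subsetI)
  fix A assume "A \<in> I"
  then obtain \<alpha> where "A \<subseteq> U `` {\<alpha>}" using assms(2) by metis
  then show "\<exists>A'\<in>range (\<lambda>x. U `` {x}). A \<subseteq> A'" by (rule bexI) (rule rangeI)
qed (rule assms(1))+

text \<open>
  A member of the Fubini product is covered by two pieces: a cylinder over a set of \<open>I\<close>, and a set
  all of whose sections belong to \<open>J\<close>. Accordingly \<open>K\<close> is parametrized by the code \<open>\<alpha>\<close> alone,
  and \<open>N\<close> by the pair of the code and the first coordinate.
\<close>

lemma universal_for_fubini_productI:
  fixes N :: "(((nat \<Rightarrow> nat) \<times> 'a::topological_space) \<times> 'b::topological_space) set"
    and K :: "((nat \<Rightarrow> nat) \<times> 'a) set"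
  assumes "Sigma03 N" "Sigma03 K"
    and N: "\<And>p. N `` {p} \<in> J" and K: "\<And>\<alpha>. K `` {\<alpha>} \<in> I"
    and sub: "\<And>S T. S \<in> I \<Longrightarrow> T \<subseteq> S \<Longrightarrow> T \<in> I"
    and cover: "\<And>B. B \<in> sets borel \<Longrightarrow> {x. B `` {x} \<notin> J} \<in> I \<Longrightarrow>
      \<exists>\<alpha>. \<forall>x y. (x, y) \<in> B \<longrightarrow> (\<alpha>, x) \<in> K \<or> ((\<alpha>, x), y) \<in> N"
  shows "\<exists>U. Sigma03 U \<and> universal_for U (fubini_product I J)"
proof (intro exI conjI)
  let ?N = "(\<lambda>(\<alpha>, x, y). ((\<alpha>, x), y)) -` N" and ?K = "(\<lambda>(\<alpha>, x, y). (\<alpha>, x)) -` K"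
  let ?U = "?N \<union> ?K"
  have "continuous_on UNIV (\<lambda>(\<alpha> :: nat \<Rightarrow> nat, x :: 'a, y :: 'b). ((\<alpha>, x), y))"
    "continuous_on UNIV (\<lambda>(\<alpha> :: nat \<Rightarrow> nat, x :: 'a, y :: 'b). (\<alpha>, x))"
    unfolding case_prod_unfold by (intro continuous_intros)+
  then show U: "Sigma03 ?U"
    using assms(1,2) by (intro Sigma03_Un Sigma03_vimage)
  have sec: "?U `` {\<alpha>} = {(x, y). ((\<alpha>, x), y) \<in> N \<or> (\<alpha>, x) \<in> K}" for \<alpha>
    by auto
  have "?U `` {\<alpha>} \<in> fubini_product I J" for \<alpha>
  proof -
    have "?U `` {\<alpha>} = Pair \<alpha> -` ?U" by auto
    moreover have "Sigma03 (Pair \<alpha> -` ?U)"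
      by (intro Sigma03_vimage U continuous_intros)
    ultimately have "?U `` {\<alpha>} \<in> sets borel"
      by (simp add: Sigma03_imp_borel)
    moreover have "{x. (?U `` {\<alpha>}) `` {x} \<notin> J} \<subseteq> K `` {\<alpha>}"
    proof
      fix x assume x: "x \<in> {x. (?U `` {\<alpha>}) `` {x} \<notin> J}"
      show "x \<in> K `` {\<alpha>}"
      proof (rule ccontr)
        assume "x \<notin> K `` {\<alpha>}"
        then have "(?U `` {\<alpha>}) `` {x} = N `` {(\<alpha>, x)}" by auto
        with x N show False by simp
      qed
    qed
    then have "{x. (?U `` {\<alpha>}) `` {x} \<notin> J} \<in> I" by (rule sub[OF K])
    ultimately show ?thesis unfolding fubini_product_def by blast
  qed
  moreover have "\<exists>\<alpha>. A \<subseteq> ?U `` {\<alpha>}" if A: "A \<in> fubini_product I J" for A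
  proof -
    obtain B where B: "B \<in> sets borel" "A \<subseteq> B" "{x. B `` {x} \<notin> J} \<in> I"
      using A unfolding fubini_product_def by blast
    then obtain \<alpha> where "\<forall>x y. (x, y) \<in> B \<longrightarrow> (\<alpha>, x) \<in> K \<or> ((\<alpha>, x), y) \<in> N"
      using cover by blast
    then have "A \<subseteq> ?U `` {\<alpha>}" using B(2) unfolding sec by auto
    then show ?thesis by blast
  qed
  ultimately show "universal_for ?U (fubini_product I J)"
    by (rule universal_forI)
qed

section \<open>Borel sets up to a meager set of sections\<close>

lemma ennreal_mult_half_power_pos: "e > 0 \<Longrightarrow> e * (1 / 2 :: ennreal) ^ n > 0"
  by (simp add: ennreal_zero_less_mult_iff ennreal_half_power)

lemma ennreal_half_plus_half: "e * (1 / 2 :: ennreal) + e * (1 / 2) = e"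
proof -
  have "(1 / 2 :: ennreal) + 1 / 2 = 1"
  proof -
    have "(1 / 2 :: ennreal) = ennreal (1 / 2)"
      using ennreal_half_power[of 1] by (simp only: power_one_right)
    moreover have "ennreal (1 / 2) + ennreal (1 / 2) = 1"
      by (subst ennreal_plus[symmetric]) simp_all
    ultimately show ?thesis by (simp only:)
  qed
  then show ?thesis by (simp add: distrib_left[symmetric])
qed

text \<open>
  In a metric space closed sets are \<open>G\<^sub>\<delta>\<close>, so the Borel sets arise from the open ones without
  complements. This form of induction fits properties, such as approximability from outside, that
  say nothing about the complement.
\<close>

lemma borel_induct_open_UN_INT [consumes 1, case_names Open UN INT]:
  fixes B :: "'a::metric_space set"
  assumes "B \<in> sets borel"
    and opn: "\<And>S. open S \<Longrightarrow> P S"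
    and UN: "\<And>F :: nat \<Rightarrow> 'a set. (\<And>n. F n \<in> sets borel) \<Longrightarrow> (\<And>n. P (F n)) \<Longrightarrow> P (\<Union>n. F n)"
    and INT: "\<And>F :: nat \<Rightarrow> 'a set. (\<And>n. F n \<in> sets borel) \<Longrightarrow> (\<And>n. P (F n)) \<Longrightarrow> P (\<Inter>n. F n)"
  shows "P B"
proof -
  have "B \<in> sigma_sets UNIV {S. open S}" using assms(1) by (simp add: borel_def)
  then have "B \<in> sets borel \<and> P B \<and> P (- B)"
  proof induct
    case (Basic a)
    then have "gdelta (- a)" by (intro closed_imp_gdelta) auto
    then obtain F :: "nat \<Rightarrow> 'a set" where F: "\<And>n. open (F n)" "- a = (\<Inter>n. F n)"
      by (metis gdelta.cases)
    have "P (\<Inter>n. F n)" using F(1) opn by (intro INT) auto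
    with Basic F(2) opn show ?case by auto
  next
    case Empty
    show ?case using opn[of "{}"] opn[of UNIV] by simp
  next
    case (Compl a)
    then show ?case by (auto simp: Compl_eq_Diff_UNIV[symmetric] intro: borel_comp)
  next
    case (Union a)
    then have "P (\<Union>n. a n)" "P (\<Inter>n. - a n)"
      by (auto intro!: UN INT borel_comp)
    with Union show ?case by auto
  qed
  then show ?thesis by blast
qed

lemma borel_section:
  fixes B :: "('a::second_countable_topology \<times> 'b::second_countable_topology) set"
  assumes "B \<in> sets borel"
  shows "B `` {x} \<in> sets borel"
  unfolding Image_singleton_eq_vimage
  using measurable_sets[OF borel_measurable_continuous_onI[of "Pair x"] assms]
  by (simp add: continuous_intros)

lemma borel_measurable_emeasure_section:
  fixes B :: "('a::second_countable_topology \<times> 'b::second_countable_topology) set"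
  assumes "sigma_finite_measure M" "sets M = sets borel" "B \<in> sets borel"
  shows "(\<lambda>x. emeasure M (B `` {x})) \<in> borel_measurable borel"
proof -
  interpret sigma_finite_measure M by fact
  have "sets ((borel :: 'a measure) \<Otimes>\<^sub>M M) = sets (borel :: ('a \<times> 'b) measure)"
    using sets_pair_measure_cong[OF refl[of "sets (borel :: 'a measure)"] assms(2)]
    by (simp only: borel_prod)
  then show ?thesis
    unfolding Image_singleton_eq_vimage using assms(3) by (intro measurable_emeasure_Pair) simp
qed

text \<open>
  Outside a meager set of \<open>x\<close>, the sections of a Borel set are approximated from outside in measure
  by the sections of one open set. Countable unions are immediate. For an intersection of sets \<open>F n\<close>,
  the sections of the partial intersections \<open>C n\<close> decrease to that of the whole, but the \<open>n\<close> at
  which the remaining measure is small depends on \<open>x\<close>. It does so in a Borel way, so by the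
  property of Baire the least possible \<open>n\<close> is, up to a meager set, constant on open sets \<open>P n\<close>. Over \<open>P n\<close> the intersection of
  the first open covers can be used, and the result is still open.
\<close>

lemma borel_open_cover_mod_meager:
  fixes B :: "('a::{metric_space,second_countable_topology} \<times> 'b::polish_space) set"
  assumes M: "finite_measure M" "sets M = sets borel"
    and "B \<in> sets borel" "e > 0"
  shows "\<exists>W E. open W \<and> E \<in> meager_ideal \<and>
    (\<forall>x. x \<notin> E \<longrightarrow> B `` {x} \<subseteq> W `` {x} \<and> emeasure M (W `` {x} - B `` {x}) \<le> e)"
  using assms(3,4)
proof (induct arbitrary: e rule: borel_induct_open_UN_INT)
  case (Open S)
  have "{} \<in> (meager_ideal :: 'a set set)"
    by (auto simp: meager_ideal_iff intro!: exI[of _ "\<lambda>_. UNIV"])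
  with Open show ?case by (intro exI[of _ S] exI[of _ "{}"]) auto
next
  case (UN F)
  have "\<exists>W E. open W \<and> E \<in> meager_ideal \<and> (\<forall>x. x \<notin> E \<longrightarrow>
      F n `` {x} \<subseteq> W `` {x} \<and> emeasure M (W `` {x} - F n `` {x}) \<le> e * (1 / 2) ^ Suc n)" for n
    by (intro UN.hyps(2) UN.prems ennreal_mult_half_power_pos)
  then obtain W E where W: "\<And>n. open (W n)" and E: "\<And>n. E n \<in> meager_ideal"
    and WE: "\<And>n x. x \<notin> E n \<Longrightarrow> F n `` {x} \<subseteq> W n `` {x}"
      "\<And>n x. x \<notin> E n \<Longrightarrow> emeasure M (W n `` {x} - F n `` {x}) \<le> e * (1 / 2) ^ Suc n"
    by metis
  have meas: "W n `` {x} \<in> sets M" "F n `` {x} \<in> sets M" for n x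
    using W UN.hyps(1) M(2) by (auto intro: borel_section open_section)
  show ?case
  proof (intro exI conjI allI impI)
    show "open (\<Union>n. W n)" using W by auto
    show "(\<Union>n. E n) \<in> meager_ideal" using E by (rule meager_UN)
    fix x assume x: "x \<notin> (\<Union>n. E n)"
    then show "(\<Union>n. F n) `` {x} \<subseteq> (\<Union>n. W n) `` {x}"
      using WE(1) by blast
    have "emeasure M ((\<Union>n. W n) `` {x} - (\<Union>n. F n) `` {x})
        \<le> emeasure M (\<Union>n. W n `` {x} - F n `` {x})"
      using meas by (intro emeasure_mono) auto
    also have "\<dots> \<le> e"
      using WE(2) x meas by (intro emeasure_UN_le_half_powers) auto
    finally show "emeasure M ((\<Union>n. W n) `` {x} - (\<Union>n. F n) `` {x}) \<le> e" .
  qed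
next
  case (INT F)
  define d where "d = e * (1 / 2)"
  have "d > 0"
    using ennreal_mult_half_power_pos[OF INT.prems, of 1] by (simp add: d_def)
  have half: "d + d = e"
    unfolding d_def by (rule ennreal_half_plus_half)
  have "\<exists>W E. open W \<and> E \<in> meager_ideal \<and> (\<forall>x. x \<notin> E \<longrightarrow>
      F n `` {x} \<subseteq> W `` {x} \<and> emeasure M (W `` {x} - F n `` {x}) \<le> d * (1 / 2) ^ Suc n)" for n
    by (intro INT.hyps(2) ennreal_mult_half_power_pos \<open>d > 0\<close>)
  then obtain W E where W: "\<And>n. open (W n)" and E: "\<And>n. E n \<in> meager_ideal"
    and WE: "\<And>n x. x \<notin> E n \<Longrightarrow> F n `` {x} \<subseteq> W n `` {x}"
      "\<And>n x. x \<notin> E n \<Longrightarrow> emeasure M (W n `` {x} - F n `` {x}) \<le> d * (1 / 2) ^ Suc n"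
    by metis
  define B where "B = (\<Inter>n. F n)"
  define C where "C n = (\<Inter>i\<le>n. F i)" for n
  define V where "V n = (\<Inter>i\<le>n. W i)" for n
  have borel: "B \<in> sets borel" "C n \<in> sets borel" "open (V n)" for n
    using INT.hyps(1) W by (auto simp: B_def C_def V_def)
  have meas: "W n `` {x} \<in> sets M" "F n `` {x} \<in> sets M" "B `` {x} \<in> sets M"
      "C n `` {x} \<in> sets M" "V n `` {x} \<in> sets M" for n x
    using W INT.hyps(1) M(2) borel by (auto intro: borel_section open_section)
  \<comment> \<open>The point \<open>x\<close> lies in \<open>disjointed S n\<close> iff \<open>n\<close> is the first index that is good enough at \<open>x\<close>.\<close>
  define S where "S n = {x. emeasure M ((C n - B) `` {x}) \<le> d}" for n
  have S_borel: "S n \<in> sets borel" for n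
    using borel_measurable_emeasure_section[OF finite_measure.axioms(1)[OF M(1)] M(2), of "C n - B"] borel
    unfolding S_def by measurable
  have S_UN: "(\<Union>n. S n) = UNIV"
  proof -
    have "\<exists>n. x \<in> S n" for x
    proof -
      have "(\<lambda>n. emeasure M ((C n - B) `` {x})) \<longlonglongrightarrow> emeasure M (\<Inter>n. (C n - B) `` {x})"
      proof (rule Lim_emeasure_decseq)
        show "range (\<lambda>n. (C n - B) `` {x}) \<subseteq> sets M"
          using borel M(2) by (auto intro: borel_section)
        show "decseq (\<lambda>n. (C n - B) `` {x})"
          by (rule decseq_SucI) (auto simp: C_def)
        show "emeasure M ((C n - B) `` {x}) \<noteq> \<infinity>" for n
          using finite_measure.emeasure_finite[OF M(1)] by simp
      qed
      moreover have "(\<Inter>n. (C n - B) `` {x}) = {}"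
        by (auto simp: B_def C_def)
      ultimately have "(\<lambda>n. emeasure M ((C n - B) `` {x})) \<longlonglongrightarrow> 0" by simp
      then have "\<forall>\<^sub>F n in sequentially. emeasure M ((C n - B) `` {x}) < d"
        using \<open>d > 0\<close> by (rule order_tendstoD)
      then obtain n where "emeasure M ((C n - B) `` {x}) < d"
        by (auto simp: eventually_sequentially)
      then show ?thesis unfolding S_def by (auto intro: less_imp_le)
    qed
    then show ?thesis by blast
  qed
  have "disjointed S n \<in> sets borel" for n
    using S_borel sets.range_disjointed_sets[of S borel] by auto
  then have "\<forall>n. \<exists>P. open P \<and> sym_diff (disjointed S n) P \<in> meager_ideal"
    using borel_property_of_Baire by blast
  then obtain P where P: "\<And>n. open (P n)" "\<And>n. sym_diff (disjointed S n) (P n) \<in> meager_ideal"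
    by metis
  define E' where "E' = (\<Union>n. E n) \<union> (\<Union>n. sym_diff (disjointed S n) (P n))"
  have "E' \<in> meager_ideal" unfolding E'_def by (intro meager_Un[OF meager_UN meager_UN] E P(2))
  define W' where "W' = (\<Union>n. V n \<inter> P n \<times> UNIV)"
  show ?case
    unfolding B_def[symmetric]
  proof (intro exI conjI allI impI)
    show "open W'"
      unfolding W'_def using borel(3) P(1) by (intro open_UN ballI open_Int open_Times) auto
    show "E' \<in> meager_ideal" by fact
    fix x assume x: "x \<notin> E'"
    have Pn: "x \<in> P n \<longleftrightarrow> x \<in> disjointed S n" for n
      using x unfolding E'_def by blast
    have "x \<in> (\<Union>n. disjointed S n)" unfolding UN_disjointed_eq S_UN by simp
    then obtain n where n: "x \<in> disjointed S n" by blast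
    have "m = n" if "x \<in> P m" for m
      using disjoint_family_disjointed[of S] n that unfolding Pn disjoint_family_on_def by blast
    then have "x \<in> P m \<longleftrightarrow> m = n" for m
      using n Pn by blast
    \<comment> \<open>The sets \<open>P m\<close> may overlap, but no point outside of the exceptional set lies in two of them.\<close>
    then have W'x: "W' `` {x} = V n `` {x}"
      unfolding W'_def by (simp add: set_eq_iff)
    have "F i `` {x} \<subseteq> W i `` {x}" for i
      using WE(1) x unfolding E'_def by blast
    then have sub: "C n `` {x} \<subseteq> V n `` {x}" "B `` {x} \<subseteq> C n `` {x}"
      unfolding B_def C_def V_def by blast+
    have "emeasure M (V n `` {x} - C n `` {x}) \<le> emeasure M (\<Union>i. W i `` {x} - F i `` {x})"
      using meas by (intro emeasure_mono) (auto simp: V_def C_def)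
    also have "\<dots> \<le> d"
      using WE(2) x meas unfolding E'_def by (intro emeasure_UN_le_half_powers) auto
    finally have 1: "emeasure M (V n `` {x} - C n `` {x}) \<le> d" .
    have "x \<in> S n" using n disjointed_subset[of S n] by blast
    then have 2: "emeasure M (C n `` {x} - B `` {x}) \<le> d"
      unfolding S_def by (simp add: Image_singleton_eq_vimage vimage_Diff)
    have "emeasure M (V n `` {x} - B `` {x})
        \<le> emeasure M ((V n `` {x} - C n `` {x}) \<union> (C n `` {x} - B `` {x}))"
      using meas by (intro emeasure_mono) auto
    also have "\<dots> \<le> emeasure M (V n `` {x} - C n `` {x}) + emeasure M (C n `` {x} - B `` {x})"
      using meas by (intro emeasure_subadditive) auto
    also have "\<dots> \<le> d + d" using 1 2 by (rule add_mono)
    finally show "emeasure M (W' `` {x} - B `` {x}) \<le> e"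
      unfolding W'x half .
    show "B `` {x} \<subseteq> W' `` {x}" using sub W'x by simp
  qed
qed

section \<open>Borel sets up to a null set of sections\<close>

text \<open>
  Outside a set of small measure, the sections of a Borel set agree with those of one open set
  \<open>V\<close> up to meager sets, which are moreover covered by the complements of a sequence of open sets
  \<open>D k\<close> with dense sections: a uniform version of the property of Baire. For a complement, the
  section of \<open>V\<close> has to be replaced by its exterior, which contains the basic set \<open>b n\<close> iff \<open>x\<close> lies in
  the closed set \<open>C n\<close>. Outer regularity replaces \<open>C n\<close> by an open set \<open>U n\<close> at the cost of a small
  set of \<open>x\<close>, which makes the exterior open in both variables.
\<close>

lemma borel_open_sections_mod_null:
  fixes B :: "('a::polish_space \<times> 'b::second_countable_topology) set"
  assumes M: "finite_measure M" "sets M = sets borel"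
    and "B \<in> sets borel" "e > 0"
  shows "\<exists>E V D. E \<in> sets borel \<and> emeasure M E \<le> e \<and> open V \<and> (\<forall>k::nat. open (D k)) \<and>
    (\<forall>x. x \<notin> E \<longrightarrow> (\<forall>k. closure (D k `` {x}) = UNIV) \<and>
      sym_diff (B `` {x}) (V `` {x}) \<subseteq> (\<Union>k. - D k `` {x}))"
proof -
  have "B \<in> sigma_sets UNIV {S. open S}" using assms(3) by (simp add: borel_def)
  then show ?thesis using \<open>e > 0\<close>
  proof (induct arbitrary: e)
    case (Basic a)
    then show ?case
      by (intro exI[of _ "{}"] exI[of _ a] exI[of _ "\<lambda>_. UNIV"]) (auto simp: Image_singleton_eq_vimage)
  next
    case Empty
    then show ?case
      by (intro exI[of _ "{}"] exI[of _ "{}"] exI[of _ "\<lambda>_. UNIV"]) (auto simp: Image_singleton_eq_vimage)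
  next
    case (Compl a)
    define d where "d = e * (1 / 2)"
    have "d > 0"
      using ennreal_mult_half_power_pos[OF Compl.prems, of 1] by (simp add: d_def)
    have half: "d + d = e"
      unfolding d_def by (rule ennreal_half_plus_half)
    obtain E V D where E: "E \<in> sets borel" "emeasure M E \<le> d" and V: "open V"
      and D: "\<And>k::nat. open (D k)"
      and EVD: "\<And>x k. x \<notin> E \<Longrightarrow> closure (D k `` {x}) = UNIV"
        "\<And>x. x \<notin> E \<Longrightarrow> sym_diff (a `` {x}) (V `` {x}) \<subseteq> (\<Union>k. - D k `` {x})"
      using Compl.hyps(2)[OF \<open>d > 0\<close>] by metis
    obtain b :: "nat \<Rightarrow> 'b set" where b: "\<And>n. open (b n)" "{} \<in> range b"
        "\<And>S x. open S \<Longrightarrow> x \<in> S \<Longrightarrow> \<exists>n. x \<in> b n \<and> b n \<subseteq> S"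
      using countable_basis_sequence by blast
    define C where "C n = - fst ` (V \<inter> UNIV \<times> b n)" for n
    have C: "x \<in> C n \<longleftrightarrow> V `` {x} \<inter> b n = {}" for x n
      unfolding C_def by force
    have C_borel: "C n \<in> sets borel" for n
      unfolding C_def using V b(1) by (intro borel_comp borel_open open_image_fst open_Int open_Times) auto
    have "\<exists>U. open U \<and> C n \<subseteq> U \<and> emeasure M (U - C n) \<le> d * (1 / 2) ^ Suc n" for n
      by (intro outer_regular_Diff M C_borel ennreal_mult_half_power_pos \<open>d > 0\<close>)
    then obtain U where U: "\<And>n. open (U n)" "\<And>n. C n \<subseteq> U n"
        "\<And>n. emeasure M (U n - C n) \<le> d * (1 / 2) ^ Suc n" by metis
    define V' where "V' = (\<Union>n. U n \<times> b n)"
    define E' where "E' = E \<union> (\<Union>n. U n - C n)"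
    \<comment> \<open>The additional set \<open>D' 0\<close> accounts for the boundary of the section of \<open>V\<close>.\<close>
    define D' where "D' k = (case k of 0 \<Rightarrow> V \<union> V' | Suc k \<Rightarrow> D k)" for k
    have "open V'" unfolding V'_def using U(1) b(1) by (intro open_UN ballI open_Times) auto
    then have D'_open: "\<forall>k. open (D' k)" using V D by (auto simp: D'_def split: nat.split)
    have E'_borel: "E' \<in> sets borel"
      unfolding E'_def using E(1) U(1) C_borel by auto
    have "emeasure M E' \<le> emeasure M E + emeasure M (\<Union>n. U n - C n)"
      unfolding E'_def using E(1) U(1) C_borel M(2) by (intro emeasure_subadditive) auto
    also have "\<dots> \<le> d + d"
      using E(2) U C_borel M(2) by (intro add_mono emeasure_UN_le_half_powers) auto
    finally have E'_small: "emeasure M E' \<le> e" using half by simp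
    have V'x: "V' `` {x} = (\<Union>n\<in>{n. V `` {x} \<inter> b n = {}}. b n)" if "x \<notin> E'" for x
    proof -
      have "x \<in> U n \<longleftrightarrow> V `` {x} \<inter> b n = {}" for n
        using that U(2)[of n] unfolding E'_def C[symmetric] by blast
      then show ?thesis unfolding V'_def by auto
    qed
    show ?case
    proof (intro exI conjI; (intro allI impI conjI)?)
      show "E' \<in> sets borel" "emeasure M E' \<le> e" "open V'" by fact+
      show "open (D' k)" for k using D'_open by blast
      fix x assume x: "x \<notin> E'"
      have "x \<notin> E" using x by (simp add: E'_def)
      have dense: "closure ((V \<union> V') `` {x}) = UNIV"
      proof (rule ccontr)
        assume "closure ((V \<union> V') `` {x}) \<noteq> UNIV"
        then obtain y where "y \<in> - closure ((V \<union> V') `` {x})" by blast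
        then obtain n where n: "y \<in> b n" "b n \<subseteq> - closure ((V \<union> V') `` {x})"
          using b(3)[of "- closure ((V \<union> V') `` {x})" y] by auto
        then have disj: "b n \<inter> (V \<union> V') `` {x} = {}"
          using closure_subset[of "(V \<union> V') `` {x}"] by blast
        then have "V `` {x} \<inter> b n = {}" by blast
        then have "b n \<subseteq> V' `` {x}" unfolding V'x[OF x] by blast
        with disj n(1) show False by blast
      qed
      then show "closure (D' k `` {x}) = UNIV" for k
        using EVD(1)[OF \<open>x \<notin> E\<close>] by (auto simp: D'_def split: nat.split)
      have "V `` {x} \<inter> V' `` {x} = {}" unfolding V'x[OF x] by blast
      then have "sym_diff ((UNIV - a) `` {x}) (V' `` {x})
          \<subseteq> sym_diff (a `` {x}) (V `` {x}) \<union> - ((V \<union> V') `` {x})"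
        by blast
      also have "\<dots> \<subseteq> (\<Union>k. - D k `` {x}) \<union> - ((V \<union> V') `` {x})"
        using EVD(2)[OF \<open>x \<notin> E\<close>] by blast
      also have "\<dots> \<subseteq> (\<Union>k. - D' k `` {x})"
      proof -
        have "D' 0 = V \<union> V'" "D' (Suc k) = D k" for k by (simp_all add: D'_def)
        then have "- ((V \<union> V') `` {x}) = - D' 0 `` {x}" "- D k `` {x} = - D' (Suc k) `` {x}" for k
          by simp_all
        then show ?thesis by blast
      qed
      finally show "sym_diff ((UNIV - a) `` {x}) (V' `` {x}) \<subseteq> (\<Union>k. - D' k `` {x})" .
    qed
  next
    case (Union a)
    have "\<exists>E V D. E \<in> sets borel \<and> emeasure M E \<le> e * (1 / 2) ^ Suc n \<and> open V \<and> (\<forall>k::nat. open (D k)) \<and>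
      (\<forall>x. x \<notin> E \<longrightarrow> (\<forall>k. closure (D k `` {x}) = UNIV) \<and>
        sym_diff (a n `` {x}) (V `` {x}) \<subseteq> (\<Union>k. - D k `` {x}))" for n
      by (intro Union.hyps(2) Union.prems ennreal_mult_half_power_pos)
    then obtain E V D where E: "\<And>n. E n \<in> sets borel" "\<And>n. emeasure M (E n) \<le> e * (1 / 2) ^ Suc n"
      and V: "\<And>n. open (V n)" and D: "\<And>n k::nat. open (D n k)"
      and EVD: "\<And>n x k. x \<notin> E n \<Longrightarrow> closure (D n k `` {x}) = UNIV"
        "\<And>n x. x \<notin> E n \<Longrightarrow> sym_diff (a n `` {x}) (V n `` {x}) \<subseteq> (\<Union>k. - D n k `` {x})"
      by metis
    define D' where "D' m = D (fst (prod_decode m)) (snd (prod_decode m))" for m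
    show ?case
    proof (intro exI conjI; (intro allI impI conjI)?)
      show "emeasure M (\<Union>n. E n) \<le> e"
        using E M(2) by (intro emeasure_UN_le_half_powers) auto
      show "(\<Union>n. E n) \<in> sets borel" "open (\<Union>n. V n)" "open (D' k)" for k
        using E(1) V D by (auto simp: D'_def)
      fix x assume x: "x \<notin> (\<Union>n. E n)"
      then show "closure (D' k `` {x}) = UNIV" for k
        using EVD(1) by (auto simp: D'_def)
      show "sym_diff ((\<Union>n. a n) `` {x}) ((\<Union>n. V n) `` {x}) \<subseteq> (\<Union>k. - D' k `` {x})"
      proof
        fix y assume "y \<in> sym_diff ((\<Union>n. a n) `` {x}) ((\<Union>n. V n) `` {x})"
        then obtain n where "y \<in> sym_diff (a n `` {x}) (V n `` {x})" by blast
        then obtain k where "y \<in> - D n k `` {x}" using EVD(2)[of x n] x by blast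
        then show "y \<in> (\<Union>k. - D' k `` {x})"
          by (intro UN_I[of "prod_encode (n, k)"]) (auto simp: D'_def)
      qed
    qed
  qed
qed

section \<open>Universal sets for the Fubini products\<close>

lemma null_ideal_Un:
  assumes "S \<in> null_ideal M" "T \<in> null_ideal M"
  shows "S \<union> T \<in> null_ideal M"
proof -
  obtain S' T' where "S' \<in> null_sets M" "S \<subseteq> S'" "T' \<in> null_sets M" "T \<subseteq> T'"
    using assms unfolding null_ideal_iff by blast
  then show ?thesis
    unfolding null_ideal_iff by (intro bexI[of _ "S' \<union> T'"]) auto
qed

text \<open>
  The second sequence is regarded as one of families of open sets with parameter \<open>(\<alpha>, x)\<close>,
  so that \<^const>\<open>null_part\<close> and \<^const>\<open>meager_part\<close> act on the sections over \<open>x\<close>.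
\<close>

lemma universal_open_sequences_with_parameter:
  obtains W1 :: "nat \<Rightarrow> ((nat \<Rightarrow> nat) \<times> 'a::second_countable_topology) set"
      and W2 :: "nat \<Rightarrow> (((nat \<Rightarrow> nat) \<times> 'a) \<times> 'b::second_countable_topology) set"
  where "\<forall>k. open (W1 k)" "\<forall>k. open (W2 k)"
    "\<forall>G1 G2. (\<forall>k. open (G1 k)) \<and> (\<forall>k. open (G2 k)) \<longrightarrow>
      (\<exists>\<alpha>. \<forall>k. W1 k `` {\<alpha>} = G1 k \<and> (\<forall>x. W2 k `` {(\<alpha>, x)} = G2 k `` {x}))"
proof -
  obtain W1 :: "nat \<Rightarrow> ((nat \<Rightarrow> nat) \<times> 'a) set" and W2 :: "nat \<Rightarrow> ((nat \<Rightarrow> nat) \<times> ('a \<times> 'b)) set"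
    where W: "\<forall>k. open (W1 k)" "\<forall>k. open (W2 k)"
      and code: "\<forall>G1 G2. (\<forall>k. open (G1 k)) \<and> (\<forall>k. open (G2 k)) \<longrightarrow>
        (\<exists>\<alpha>. \<forall>k. W1 k `` {\<alpha>} = G1 k \<and> W2 k `` {\<alpha>} = G2 k)"
    by (rule universal_open_sequences) (rule that)
  define W2' where "W2' k = (\<lambda>((\<alpha>, x), y). (\<alpha>, x, y)) -` W2 k" for k
  show ?thesis
  proof (rule that[of W1 W2'])
    show "\<forall>k. open (W2' k)"
      unfolding W2'_def case_prod_unfold by (intro allI open_vimage W[rule_format] continuous_intros)
    show "\<forall>G1 G2. (\<forall>k. open (G1 k)) \<and> (\<forall>k. open (G2 k)) \<longrightarrow>
      (\<exists>\<alpha>. \<forall>k. W1 k `` {\<alpha>} = G1 k \<and> (\<forall>x. W2' k `` {(\<alpha>, x)} = G2 k `` {x}))"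
    proof (intro allI impI)
      fix G1 :: "nat \<Rightarrow> 'a set" and G2 :: "nat \<Rightarrow> ('a \<times> 'b) set"
      assume "(\<forall>k. open (G1 k)) \<and> (\<forall>k. open (G2 k))"
      then obtain \<alpha> where \<alpha>: "\<forall>k. W1 k `` {\<alpha>} = G1 k \<and> W2 k `` {\<alpha>} = G2 k"
        using code by blast
      have "W2' k `` {(\<alpha>, x)} = (W2 k `` {\<alpha>}) `` {x}" for k x
        unfolding W2'_def by auto
      with \<alpha> show "\<exists>\<alpha>. \<forall>k. W1 k `` {\<alpha>} = G1 k \<and> (\<forall>x. W2' k `` {(\<alpha>, x)} = G2 k `` {x})"
        by (intro exI[of _ \<alpha>]) simp
    qed
  qed (rule W(1))
qed

text \<open>
  Both exceptional sets of \<open>x\<close>, those where the section is not null and those where one of the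
  approximations fails, are meager and are absorbed in \<open>meager_part W1\<close>. For the remaining \<open>x\<close> the
  section is null, and so the approximating open sets have small sections themselves.
\<close>

theorem Sigma03_universal_meager_null:
  fixes M :: "'b::polish_space measure"
  assumes "sigma_finite_measure M" "sets M = sets borel"
  shows "\<exists>U :: ((nat \<Rightarrow> nat) \<times> ('a::polish_space \<times> 'b)) set.
    Sigma03 U \<and> universal_for U (fubini_product meager_ideal (null_ideal M))"
proof -
  obtain M' :: "'b measure" where M': "finite_measure M'" "sets M' = sets borel"
      and same: "null_ideal M' = null_ideal M"
    using finite_borel_measure_same_null_ideal[OF assms] by blast
  obtain W1 :: "nat \<Rightarrow> ((nat \<Rightarrow> nat) \<times> 'a) set" and W2 :: "nat \<Rightarrow> (((nat \<Rightarrow> nat) \<times> 'a) \<times> 'b) set"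
    where W: "\<forall>k. open (W1 k)" "\<forall>k. open (W2 k)"
      and code: "\<forall>G1 G2. (\<forall>k. open (G1 k)) \<and> (\<forall>k. open (G2 k)) \<longrightarrow>
        (\<exists>\<alpha>. \<forall>k. W1 k `` {\<alpha>} = G1 k \<and> (\<forall>x. W2 k `` {(\<alpha>, x)} = G2 k `` {x}))"
    by (rule universal_open_sequences_with_parameter) (rule that)
  show ?thesis
    unfolding same[symmetric]
  proof (rule universal_for_fubini_productI)
    show "Sigma03 (null_part M' W2)"
      by (intro gdelta_imp_Sigma03 gdelta_null_part W[rule_format] M')
    show "Sigma03 (meager_part W1)"
      by (intro Sigma03_meager_part W[rule_format])
    show "null_part M' W2 `` {p} \<in> null_ideal M'" for p
      by (intro null_part_section W[rule_format] M')
    show "meager_part W1 `` {\<alpha>} \<in> meager_ideal" for \<alpha>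
      by (intro meager_part_section W[rule_format])
    show "T \<in> meager_ideal" if "S \<in> meager_ideal" "T \<subseteq> S" for S T :: "'a set"
      using that by (rule meager_subset)
    fix B :: "('a \<times> 'b) set"
    assume B: "B \<in> sets borel" and Z: "{x. B `` {x} \<notin> null_ideal M'} \<in> meager_ideal"
    have "\<exists>V E. open V \<and> E \<in> meager_ideal \<and> (\<forall>x. x \<notin> E \<longrightarrow>
        B `` {x} \<subseteq> V `` {x} \<and> emeasure M' (V `` {x} - B `` {x}) \<le> (1 / 2) ^ k)" for k
      by (intro borel_open_cover_mod_meager M' B) (simp add: ennreal_half_power)
    then obtain V E where V: "\<And>k::nat. open (V k)" and E: "\<And>k. E k \<in> meager_ideal"
      and VE: "\<And>k x. x \<notin> E k \<Longrightarrow> B `` {x} \<subseteq> V k `` {x}"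
        "\<And>k x. x \<notin> E k \<Longrightarrow> emeasure M' (V k `` {x} - B `` {x}) \<le> (1 / 2) ^ k"
      by metis
    have "{x. B `` {x} \<notin> null_ideal M'} \<union> (\<Union>k. E k) \<in> meager_ideal"
      by (intro meager_Un[OF Z meager_UN] E)
    then obtain D :: "nat \<Rightarrow> 'a set" where D: "\<And>k. open (D k)" "\<And>k. closure (D k) = UNIV"
      and bad: "{x. B `` {x} \<notin> null_ideal M'} \<union> (\<Union>k. E k) \<subseteq> (\<Union>k. - D k)"
      unfolding meager_ideal_iff by blast
    obtain \<alpha> where \<alpha>: "\<And>k. W1 k `` {\<alpha>} = D k" "\<And>k x. W2 k `` {(\<alpha>, x)} = V k `` {x}"
      using code[rule_format, of D V] D(1) V by blast
    have "((\<alpha>, x), y) \<in> null_part M' W2" if "(x, y) \<in> B" "(\<alpha>, x) \<notin> meager_part W1" for x y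
    proof -
      have "(\<alpha>, x) \<in> W1 k \<longleftrightarrow> x \<in> D k" for k
        by (simp add: Image_singleton_iff[symmetric] \<alpha>(1) del: Image_singleton_iff)
      then have "x \<in> D k" for k
        using that(2) by (simp add: meager_part_def \<alpha>(1) D(2))
      then have "x \<notin> (\<Union>k. - D k)" by simp
      then have null: "B `` {x} \<in> null_ideal M'" and nE: "\<And>k. x \<notin> E k"
        using subsetD[OF bad, of x] by auto
      have "B `` {x} \<in> sets M'"
        using borel_section[OF B, of x] M'(2) by simp
      then have "B `` {x} \<in> null_sets M'"
        using null null_sets_subset unfolding null_ideal_iff by blast
      then have "emeasure M' (V k `` {x}) = emeasure M' (V k `` {x} - B `` {x})" for k
        using M'(2) by (intro emeasure_Diff_null_set[symmetric]) (auto intro: open_section V borel_open)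
      then have "emeasure M' (V k `` {x}) \<le> (1 / 2) ^ k" for k
        using VE(2)[OF nE] by simp
      moreover have "((\<alpha>, x), y) \<in> W2 k" for k
        using VE(1)[OF nE, of k] \<open>(x, y) \<in> B\<close> \<alpha>(2)[of k x] by blast
      ultimately show ?thesis by (simp add: null_part_def \<alpha>(2))
    qed
    then show "\<exists>\<alpha>. \<forall>x y. (x, y) \<in> B \<longrightarrow> (\<alpha>, x) \<in> meager_part W1 \<or> ((\<alpha>, x), y) \<in> null_part M' W2"
      by (intro exI[of _ \<alpha>]) blast
  qed
qed

text \<open>
  Apply the approximation with bounds \<open>2\<^bsup>-m\<^esup>\<close> for all \<open>m\<close>: the points that are exceptional for
  every \<open>m\<close> form a null set. At any other \<open>x\<close>, some \<open>m\<close> gives an open \<open>V m\<close> whose section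
  differs from that of \<open>B\<close> by a meager set. If the section of \<open>B\<close> is meager, then the section of
  \<open>V m\<close> is open and meager, hence empty, and the section of \<open>B\<close> is covered by the complements of
  the dense open sections.
\<close>

theorem Sigma03_universal_null_meager:
  fixes M :: "'a::polish_space measure"
  assumes "sigma_finite_measure M" "sets M = sets borel"
  shows "\<exists>U :: ((nat \<Rightarrow> nat) \<times> ('a \<times> 'b::polish_space)) set.
    Sigma03 U \<and> universal_for U (fubini_product (null_ideal M) meager_ideal)"
proof -
  obtain M' :: "'a measure" where M': "finite_measure M'" "sets M' = sets borel"
      and same: "null_ideal M' = null_ideal M"
    using finite_borel_measure_same_null_ideal[OF assms] by blast
  obtain W1 :: "nat \<Rightarrow> ((nat \<Rightarrow> nat) \<times> 'a) set" and W2 :: "nat \<Rightarrow> (((nat \<Rightarrow> nat) \<times> 'a) \<times> 'b) set"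
    where W: "\<forall>k. open (W1 k)" "\<forall>k. open (W2 k)"
      and code: "\<forall>G1 G2. (\<forall>k. open (G1 k)) \<and> (\<forall>k. open (G2 k)) \<longrightarrow>
        (\<exists>\<alpha>. \<forall>k. W1 k `` {\<alpha>} = G1 k \<and> (\<forall>x. W2 k `` {(\<alpha>, x)} = G2 k `` {x}))"
    by (rule universal_open_sequences_with_parameter) (rule that)
  show ?thesis
    unfolding same[symmetric]
  proof (rule universal_for_fubini_productI)
    show "Sigma03 (null_part M' W1)"
      by (intro gdelta_imp_Sigma03 gdelta_null_part W[rule_format] M')
    show "Sigma03 (meager_part W2)"
      by (intro Sigma03_meager_part W[rule_format])
    show "null_part M' W1 `` {\<alpha>} \<in> null_ideal M'" for \<alpha>
      by (intro null_part_section W[rule_format] M')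
    show "meager_part W2 `` {p} \<in> meager_ideal" for p
      by (intro meager_part_section W[rule_format])
    show "T \<in> null_ideal M'" if "S \<in> null_ideal M'" "T \<subseteq> S" for S T
      using that by (rule null_ideal_subset)
    fix B :: "('a \<times> 'b) set"
    assume B: "B \<in> sets borel" and Z: "{x. B `` {x} \<notin> meager_ideal} \<in> null_ideal M'"
    have "\<exists>E V D. E \<in> sets borel \<and> emeasure M' E \<le> (1 / 2) ^ m \<and> open V \<and> (\<forall>k::nat. open (D k)) \<and>
        (\<forall>x. x \<notin> E \<longrightarrow> (\<forall>k. closure (D k `` {x}) = UNIV) \<and>
          sym_diff (B `` {x}) (V `` {x}) \<subseteq> (\<Union>k. - D k `` {x}))" for m
      by (intro borel_open_sections_mod_null M' B) (simp add: ennreal_half_power)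
    then obtain E V D where E: "\<And>m::nat. E m \<in> sets borel" "\<And>m. emeasure M' (E m) \<le> (1 / 2) ^ m"
      and V: "\<And>m. open (V m)" and D: "\<And>m k::nat. open (D m k)"
      and EVD: "\<And>m x k. x \<notin> E m \<Longrightarrow> closure (D m k `` {x}) = UNIV"
        "\<And>m x. x \<notin> E m \<Longrightarrow> sym_diff (B `` {x}) (V m `` {x}) \<subseteq> (\<Union>k. - D m k `` {x})"
      by metis
    have "emeasure M' (\<Inter>m. E m) \<le> (1 / 2) ^ m" for m
    proof -
      have "emeasure M' (\<Inter>m. E m) \<le> emeasure M' (E m)"
        using E(1) M'(2) by (intro emeasure_mono) auto
      with E(2) show ?thesis using order_trans by blast
    qed
    then have "(\<Inter>m. E m) \<in> null_sets M'"
      using E(1) M'(2) by (intro null_setsI ennreal_le_half_powers_imp_zero) auto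
    then have "{x. B `` {x} \<notin> meager_ideal} \<union> (\<Inter>m. E m) \<in> null_ideal M'"
      by (intro null_ideal_Un Z) (auto simp: null_ideal_iff)
    then obtain G where G: "\<And>k::nat. open (G k)"
      "\<And>k. {x. B `` {x} \<notin> meager_ideal} \<union> (\<Inter>m. E m) \<subseteq> G k"
      "\<And>k. emeasure M' (G k) \<le> (1 / 2) ^ k"
      using null_ideal_open_cover[OF M'] by blast
    define D' where "D' k = D (fst (prod_decode k)) (snd (prod_decode k))" for k
    have "\<And>k. open (D' k)" using D by (simp add: D'_def)
    then obtain \<alpha> where \<alpha>: "\<And>k. W1 k `` {\<alpha>} = G k" "\<And>k x. W2 k `` {(\<alpha>, x)} = D' k `` {x}"
      using code[rule_format, of G D'] G(1) by blast
    have "((\<alpha>, x), y) \<in> meager_part W2" if "(x, y) \<in> B" "(\<alpha>, x) \<notin> null_part M' W1" for x y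
    proof -
      have "(\<alpha>, x) \<in> W1 k \<longleftrightarrow> x \<in> G k" for k
        by (simp add: Image_singleton_iff[symmetric] \<alpha>(1) del: Image_singleton_iff)
      then have "\<exists>k. x \<notin> G k"
        using that(2) by (simp add: null_part_def \<alpha>(1) G(3))
      then have "x \<notin> {x. B `` {x} \<notin> meager_ideal} \<union> (\<Inter>m. E m)"
        using G(2) by (meson subsetD)
      then obtain m where m: "B `` {x} \<in> meager_ideal" "x \<notin> E m"
        by auto
      have "(\<Union>k. - D m k `` {x}) \<in> meager_ideal"
        using D EVD(1)[OF m(2)] by (intro meager_UN Compl_dense_open_meager open_section)
      then have "B `` {x} \<union> (\<Union>k. - D m k `` {x}) \<in> meager_ideal"
        by (rule meager_Un[OF m(1)])
      then have "V m `` {x} \<in> meager_ideal"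
        by (rule meager_subset) (use EVD(2)[OF m(2)] in blast)
      then have "V m `` {x} = {}"
        using V by (intro open_meager_empty open_section)
      then have "B `` {x} \<subseteq> (\<Union>k. - D m k `` {x})"
        using EVD(2)[OF m(2)] by simp
      then have "y \<in> (\<Union>k. - D m k `` {x})"
        using that(1) by (rule subsetD[OF _ ImageI]) simp
      then obtain k where "y \<notin> D m k `` {x}"
        by (elim UN_E ComplE)
      moreover have "W2 (prod_encode (m, k)) `` {(\<alpha>, x)} = D m k `` {x}"
        by (simp add: \<alpha>(2) D'_def)
      ultimately show ?thesis
        using EVD(1)[OF m(2), of k] unfolding meager_part_def
        by (auto intro!: exI[of _ "prod_encode (m, k)"])
    qed
    then show "\<exists>\<alpha>. \<forall>x y. (x, y) \<in> B \<longrightarrow> (\<alpha>, x) \<in> null_part M' W1 \<or> ((\<alpha>, x), y) \<in> meager_part W2"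
      by (intro exI[of _ \<alpha>]) blast
  qed
qed

lemma sets_cantor_measure: "sets cantor_measure = sets borel"
proof -
  have "sets (uniform_count_measure (UNIV :: bool set)) = sets borel"
    by (simp add: sets_borel_eq_count_space)
  then have "sets cantor_measure = sets (\<Pi>\<^sub>M i\<in>(UNIV :: nat set). (borel :: bool measure))"
    unfolding cantor_measure_def by (intro sets_PiM_cong refl)
  then show ?thesis by (simp only: sets_PiM_equal_borel)
qed

lemma sigma_finite_cantor_measure: "sigma_finite_measure cantor_measure"
proof -
  interpret product_prob_space "\<lambda>_ :: nat. uniform_count_measure (UNIV :: bool set)" UNIV
    by (intro product_prob_spaceI prob_space_uniform_count_measure) auto
  show ?thesis unfolding cantor_measure_def by (rule P.sigma_finite_measure_axioms)
qed

theorem corollary3p2: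
  shows
    "((\<exists>U :: ((nat \<Rightarrow> nat) \<times> ((nat \<Rightarrow> bool) \<times> (nat \<Rightarrow> bool))) set.
          Sigma03 U \<and> universal_for U (fubini_product meager_ideal (null_ideal cantor_measure)))
      \<and> (\<exists>V :: ((nat \<Rightarrow> nat) \<times> ((nat \<Rightarrow> bool) \<times> (nat \<Rightarrow> bool))) set.
          Sigma03 V \<and> universal_for V (fubini_product (null_ideal cantor_measure) meager_ideal)))
   \<and> ((\<exists>U :: ((nat \<Rightarrow> nat) \<times> (real \<times> real)) set.
          Sigma03 U \<and> universal_for U (fubini_product meager_ideal (null_ideal lborel)))
      \<and> (\<exists>V :: ((nat \<Rightarrow> nat) \<times> (real \<times> real)) set.
          Sigma03 V \<and> universal_for V (fubini_product (null_ideal lborel) meager_ideal)))"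
  using sigma_finite_cantor_measure sets_cantor_measure lborel.sigma_finite_measure_axioms sets_lborel
  by (intro conjI Sigma03_universal_meager_null Sigma03_universal_null_meager)

end
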